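(* Let $(X,Y,\langle\cdot,\cdot\rangle)$ be a dual system and let $T:X\rightrightarrows Y$ be cyclically monotone. The following are equivalent: (i) $T$ is maximal cyclically monotone; (ii) $T=\partial h$ for some $h\in\Gamma_{\sigma(X,Y)}(X)$ and, for every $(x,y)\in X\times Y$, there are an integer $n\ge2$ and $(x_1,y_1),\dots,(x_{n-1},y_{n-1})\in\operatorname{Graph}T$ such that $$\langle x-x_1,y_1\rangle+\sum_{i=2}^{n-1}\langle x_{i-1}-x_i,y_i\rangle+\langle x_{n-1}-x,y\rangle\ge0,$$ where for $n=2$ this inequality reads $\langle x-x_1,y_1\rangle+\langle x_1-x,y\rangle\ge0$; (iii) $T=\partial h$ for some $h\in\Gamma_{\sigma(X,Y)}(X)$, and $\varphi_T^{\langle\infty\rangle}\ge c$; (iv) $T=\partial h$ for some $h\in\Gamma_{\sigma(X,Y)}(X)$, and $T$ admits a unique maximal cyclically monotone extension.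
   Context: All vector spaces are real. A dual system $(X,Y,\langle\cdot,\cdot\rangle)$ consists of vector spaces $X,Y$ and a bilinear map $c=\langle\cdot,\cdot\rangle:X\times Y\to\mathbb{R}$, $c(x,y)=\langle x,y\rangle$. $\sigma(X,Y)$ is the weakest topology on $X$ making all $x\mapsto\langle x,y\rangle$, $y\in Y$, continuous. $\Gamma_{\sigma(X,Y)}(X)$ is the set of proper convex $\sigma(X,Y)$-lower semicontinuous functions $X\to\overline{\mathbb R}$ (proper: not identically $+\infty$, never $-\infty$). For $h:X\to\overline{\mathbb R}$, $\partial h:X\rightrightarrows Y$ is $\partial h(x)=\{y\in Y\mid\forall w\in X,\ \langle w-x,y\rangle+h(x)\le h(w)\}$ if $h(x)\in\mathbb R$, and $\partial h(x)=\emptyset$ otherwise. For $T:X\rightrightarrows Y$, $\operatorname{Graph}T=\{(x,y)\mid y\in T(x)\}$. $T$ is cyclically monotone if for every integer $n\ge2$ and all $(x_1,y_1),\dots,(x_n,y_n)\in\operatorname{Graph}T$, with $x_{n+1}=x_1$, $\sum_{i=1}^n\langle x_i-x_{i+1},y_i\rangle\ge0$; it is maximal cyclically monotone if moreover its graph is not properly contained in the graph of another cyclically monotone operator. Extensions are understood in the sense of graph inclusion. For finite $n\ge1$, $\varphi_T^{\langle n\rangle}(x,y)=\sup\{\langle x-x_1,y_1\rangle+\sum_{i=2}^n\langle x_{i-1}-x_i,y_i\rangle+\langle x_n,y\rangle\mid (x_i,y_i)\in\operatorname{Graph}T,\ 1\le i\le n\}$, and $\varphi_T^{\langle\infty\rangle}=\sup_{n\ge1}\varphi_T^{\langle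 n\rangle}$ (with $\sup\emptyset=-\infty$). $\varphi_T^{\langle\infty\rangle}\ge c$ means the inequality holds at every point of $X\times Y$. *)

theory Defs
  imports "HOL-Analysis.Analysis"
begin

text \<open>
  A dual system is a pair of real vector spaces, given by the type variables \<open>'a\<close> and \<open>'b\<close>,
  together with a map \<open>c\<close> satisfying \<^term>\<open>bilinear c\<close>; no separation of points is required.
  Finite families indexed by \<open>{1..n}\<close> are functions on \<^typ>\<open>nat\<close> whose values outside
  the index range are irrelevant.
\<close>

definition sigma_topology ::
  "('a::real_vector \<Rightarrow> 'b::real_vector \<Rightarrow> real) \<Rightarrow> 'a topology" where
  "sigma_topology c = topology_generated_by {(\<lambda>x. c x y) -` U | y U. open U}"

definition proper_fun :: "('a \<Rightarrow> ereal) \<Rightarrow> bool" where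
  "proper_fun h \<longleftrightarrow> (\<exists>x. h x \<noteq> \<infinity>) \<and> (\<forall>x. h x \<noteq> -\<infinity>)"

text \<open>
  Only used for functions that avoid \<open>-\<infinity>\<close>, so the right-hand side is never of the form
  \<open>\<infinity> - \<infinity>\<close>.
\<close>

definition convex_fun :: "('a::real_vector \<Rightarrow> ereal) \<Rightarrow> bool" where
  "convex_fun h \<longleftrightarrow>
     (\<forall>x y. \<forall>t\<in>{0<..<1::real}.
        h ((1 - t) *\<^sub>R x + t *\<^sub>R y) \<le> ereal (1 - t) * h x + ereal t * h y)"

definition lsc_fun :: "'a topology \<Rightarrow> ('a \<Rightarrow> ereal) \<Rightarrow> bool" where
  "lsc_fun \<tau> h \<longleftrightarrow> (\<forall>r. openin \<tau> {x \<in> topspace \<tau>. r < h x})"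

definition Gamma_sigma ::
  "('a::real_vector \<Rightarrow> 'b::real_vector \<Rightarrow> real) \<Rightarrow> ('a \<Rightarrow> ereal) set" where
  "Gamma_sigma c = {h. proper_fun h \<and> convex_fun h \<and> lsc_fun (sigma_topology c) h}"

definition subdifferential ::
  "('a::real_vector \<Rightarrow> 'b::real_vector \<Rightarrow> real) \<Rightarrow> ('a \<Rightarrow> ereal) \<Rightarrow> 'a \<Rightarrow> 'b set" where
  "subdifferential c h x =
     (if \<bar>h x\<bar> \<noteq> \<infinity> then {y. \<forall>w. ereal (c (w - x) y) + h x \<le> h w} else {})"

definition Graph :: "('a \<Rightarrow> 'b set) \<Rightarrow> ('a \<times> 'b) set" where
  "Graph T = {(x, y). y \<in> T x}"

definition cyclically_monotone ::
  "('a::real_vector \<Rightarrow> 'b::real_vector \<Rightarrow> real) \<Rightarrow> ('a \<Rightarrow> 'b set) \<Rightarrow> bool" where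
  "cyclically_monotone c T \<longleftrightarrow>
     (\<forall>n\<ge>2. \<forall>(xs :: nat \<Rightarrow> 'a) (ys :: nat \<Rightarrow> 'b).
        (\<forall>i\<in>{1..n}. (xs i, ys i) \<in> Graph T) \<and> xs (n + 1) = xs 1 \<longrightarrow>
        (\<Sum>i=1..n. c (xs i - xs (i + 1)) (ys i)) \<ge> 0)"

definition maximal_cyclically_monotone ::
  "('a::real_vector \<Rightarrow> 'b::real_vector \<Rightarrow> real) \<Rightarrow> ('a \<Rightarrow> 'b set) \<Rightarrow> bool" where
  "maximal_cyclically_monotone c T \<longleftrightarrow>
     cyclically_monotone c T \<and>
     \<not> (\<exists>S. cyclically_monotone c S \<and> Graph T \<subset> Graph S)"

definition fitzpatrick ::
  "('a::real_vector \<Rightarrow> 'b::real_vector \<Rightarrow> real) \<Rightarrow> ('a \<Rightarrow> 'b set) \<Rightarrow> nat \<Rightarrow> 'a \<Rightarrow> 'b \<Rightarrow> ereal" where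
  "fitzpatrick c T n x y =
     Sup {ereal (c (x - xs 1) (ys 1) + (\<Sum>i=2..n. c (xs (i - 1) - xs i) (ys i)) + c (xs n) y)
          | (xs :: nat \<Rightarrow> 'a) (ys :: nat \<Rightarrow> 'b). \<forall>i\<in>{1..n}. (xs i, ys i) \<in> Graph T}"

definition fitzpatrick_inf ::
  "('a::real_vector \<Rightarrow> 'b::real_vector \<Rightarrow> real) \<Rightarrow> ('a \<Rightarrow> 'b set) \<Rightarrow> 'a \<Rightarrow> 'b \<Rightarrow> ereal" where
  "fitzpatrick_inf c T x y = (SUP n\<in>{1..}. fitzpatrick c T n x y)"

end

theory Submission
  imports Defs
begin

text \<open>
  A cyclically monotone relation is one that has a potential: composing subgradient inequalities
  along a chain of points of the graph ending at \<open>a\<close> gives an affine function of the starting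
  point, and the pointwise supremum of these functions is Rockafellar's potential. A point
  \<open>(x, y)\<close> can be added to \<open>T\<close> without losing cyclic monotonicity exactly when no chain from \<open>x\<close>,
  closed up by \<open>(x, y)\<close>, has positive value, and then a potential exists for the enlarged relation
  (lemma \<open>ex_Gamma_potential\<close>). Maximal relations are therefore subdifferentials, and every
  \<open>(x, y)\<close> closes some chain with a nonnegative value: outside the graph because the point cannot
  be added, on the graph by the chain with the single link \<open>(x, y)\<close>. This is (ii), which is
  stronger than (iii), because (iii) asks only for chains whose closed value exceeds any prescribed
  negative number.

  For (iv) to imply (iii), suppose that all chains closed up by \<open>(x, y)\<close> have value at most
  \<open>-d < 0\<close>. This margin permits moving \<open>x\<close> alone, or \<open>y\<close> alone, a little towards a point of the
  graph. Each of the two resulting points can be added to \<open>T\<close>, so by uniqueness both belong to the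
  same maximal extension; but the two points are not monotonically related
  (lemma \<open>chains_nearly_close_if_unique_extension\<close>).

  The substantial implication is from (iii) to (i). Let \<open>T\<close> be the subdifferential of \<open>h\<close>, let
  \<open>(x, y)\<close> belong to a cyclically monotone extension of \<open>T\<close>, and let \<open>k\<close> be a potential of \<open>T\<close>
  together with \<open>(x, y)\<close>. Both functions are suprema of affine minorants. Taking an affine minorant
  of each, nearly exact at a point \<open>u\<close>, and applying (iii) at \<open>u\<close> and the average of the two slopes,
  yields one chain which is nearly exact at \<open>u\<close> for the average of \<open>h\<close> and \<open>k\<close>. It cannot exceed
  either function, so it is nearly exact for both: \<open>h\<close> and \<open>k\<close> have common approximate subgradients
  wherever both are finite (lemma \<open>common_approximate_subgradient\<close>). Along a segment between two
  points of the domain of \<open>T\<close> this forces equal increments, so \<open>h - k\<close> is constant on that domain.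
  A further use of (iii) shows that \<open>h\<close> and \<open>k\<close>, minus any continuous linear functional, have their
  infima over the whole space determined by the domain of \<open>T\<close>, and so \<open>y\<close> is a subgradient of \<open>h\<close>
  at \<open>x\<close>.

  A lower semicontinuous convex function with a subgradient is the supremum of its affine minorants
  (lemma \<open>affine_minorant_below\<close>) because lower semicontinuity for \<open>\<sigma>(X,Y)\<close> at a given point involves
  only finitely many functionals: the separation it calls for is a theorem of the alternative for
  finitely many convex functions, proved by induction on their number.
\<close>

section \<open>A theorem of the alternative for convex functions\<close>

text \<open>
  Some multiple \<open>\<theta>\<close> makes \<open>\<theta> f + g\<close> nonnegative because the lower bounds for \<open>\<theta>\<close> imposed by the
  points where \<open>g\<close> is negative lie below the upper bounds imposed by the points where \<open>f\<close> is
  negative. Otherwise, on a segment joining two such points, convexity would make both functions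
  negative somewhere.
\<close>

lemma convex_alternative_two:
  fixes f g :: "'a::real_vector \<Rightarrow> real"
  assumes f: "convex_on K f" and g: "convex_on K g"
    and alt: "\<And>w. w \<in> K \<Longrightarrow> 0 \<le> f w \<or> 0 \<le> g w"
  shows "\<exists>t\<in>{0..1}. \<forall>w\<in>K. 0 \<le> (1 - t) * f w + t * g w"
proof (cases "(\<forall>w\<in>K. 0 \<le> f w) \<or> (\<forall>w\<in>K. 0 \<le> g w)")
  case True
  then show ?thesis
  proof
    assume "\<forall>w\<in>K. 0 \<le> f w" then show ?thesis by (intro bexI[of _ 0]) auto
  next
    assume "\<forall>w\<in>K. 0 \<le> g w" then show ?thesis by (intro bexI[of _ 1]) auto
  qed
next
  case False
  then obtain u0 v0 where u0: "u0 \<in> K" "f u0 < 0" and v0: "v0 \<in> K" "g v0 < 0"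
    by (auto simp: not_le)
  have cross: "f u * g v \<le> f v * g u"
    if u: "u \<in> K" "f u < 0" and v: "v \<in> K" "g v < 0" for u v
  proof (rule ccontr)
    assume "\<not> ?thesis"
    then have lt: "f v * g u < f u * g v" by simp
    have fv: "0 \<le> f v" and gu: "0 \<le> g u" using alt u v by force+
    \<comment> \<open>A weight ratio \<open>A\<close> of \<open>v\<close> to \<open>u\<close> cancels the bound on \<open>g\<close> exactly and leaves room in the bound
    on \<open>f\<close>; \<open>\<eta>\<close> spends part of that room to make the bound on \<open>g\<close> strict as well.\<close>
    define A where "A = g u / (- g v)"
    have A0: "0 \<le> A" using gu v unfolding A_def by (intro divide_nonneg_pos) auto
    have gA: "A * (- g v) = g u" using v unfolding A_def by simp
    have "A * f v * (- g v) = f v * g u" using gA by (metis mult.assoc mult.commute)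
    also have "\<dots> < (- f u) * (- g v)" using lt by simp
    finally have AF: "A * f v < - f u" using v(2) by (metis mult_less_cancel_right_pos neg_0_less_iff_less)
    define \<eta> where "\<eta> = (- f u - A * f v) / (f v + 1)"
    have \<eta>: "0 < \<eta>" unfolding \<eta>_def using AF fv by (intro divide_pos_pos) auto
    have "\<eta> * (f v + 1) = - f u - A * f v" unfolding \<eta>_def using fv by simp
    then have lt1: "(A + \<eta>) * f v < - f u" using \<eta> by (simp add: algebra_simps)
    have lt2: "g u < (A + \<eta>) * (- g v)"
    proof -
      have "0 < \<eta> * (- g v)" using \<eta> v by (intro mult_pos_pos) auto
      then show ?thesis using gA by (simp add: algebra_simps)
    qed
    define \<rho> where "\<rho> = A + \<eta>"
    have \<rho>: "0 < \<rho>" using A0 \<eta> unfolding \<rho>_def by simp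
    define z where "z = (1 - \<rho> / (1 + \<rho>)) *\<^sub>R u + (\<rho> / (1 + \<rho>)) *\<^sub>R v"
    have s: "0 \<le> \<rho> / (1 + \<rho>)" "\<rho> / (1 + \<rho>) \<le> 1" using \<rho> by auto
    have e: "1 - \<rho> / (1 + \<rho>) = 1 / (1 + \<rho>)" using \<rho> by (simp add: field_simps)
    have zK: "z \<in> K" unfolding z_def
      using convexD_alt[OF convex_on_imp_convex[OF f] u(1) v(1) s] .
    have "f z \<le> (f u + \<rho> * f v) / (1 + \<rho>)"
      using convex_onD[OF f s u(1) v(1)] by (simp add: z_def e add_divide_distrib)
    also have "\<dots> < 0" using lt1 \<rho> unfolding \<rho>_def[symmetric] by (intro divide_neg_pos) auto
    finally have fz: "f z < 0" .
    have "g z \<le> (g u + \<rho> * g v) / (1 + \<rho>)"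
      using convex_onD[OF g s u(1) v(1)] by (simp add: z_def e add_divide_distrib)
    also have "\<dots> < 0" using lt2 \<rho> unfolding \<rho>_def[symmetric] by (intro divide_neg_pos) auto
    finally show False using fz alt[OF zK] by simp
  qed
  have fpos: "0 < f v" if "v \<in> K" "g v < 0" for v
  proof -
    have "0 < f u0 * g v" using u0 that by (simp add: mult_neg_neg)
    then have "f v \<noteq> 0" using cross[OF u0 that] by auto
    then show ?thesis using alt[OF that(1)] that(2) by auto
  qed
  define V where "V = (\<lambda>v. - g v / f v) ` {v \<in> K. g v < 0}"
  have le: "- g v / f v \<le> g u / (- f u)" if "u \<in> K" "f u < 0" "v \<in> K" "g v < 0" for u v
  proof -
    have "- g v * (- f u) \<le> g u * f v" using cross[OF that] by (simp add: mult.commute)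
    then have "- g v \<le> g u * f v / (- f u)" using that(2) by (subst pos_le_divide_eq) auto
    then show ?thesis using fpos[OF that(3,4)] by (subst pos_divide_le_eq) auto
  qed
  have bdd: "bdd_above V" unfolding V_def using le[OF u0] by (intro bdd_aboveI2[where M = "g u0 / (- f u0)"]) blast
  define \<theta> where "\<theta> = Sup V"
  have th_ge: "- g v / f v \<le> \<theta>" if "v \<in> K" "g v < 0" for v
    unfolding \<theta>_def by (rule cSup_upper[OF _ bdd]) (use that in \<open>auto simp: V_def\<close>)
  have th_le: "\<theta> \<le> g u / (- f u)" if "u \<in> K" "f u < 0" for u
    unfolding \<theta>_def by (rule cSup_least) (use v0 le[OF that] in \<open>auto simp: V_def\<close>)
  have "0 < - g v0 / f v0" using v0 fpos[OF v0] by (intro divide_pos_pos) auto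
  then have th0: "0 < \<theta>" using th_ge[OF v0] by simp
  have main: "0 \<le> \<theta> * f w + g w" if w: "w \<in> K" for w
  proof (cases "g w < 0")
    case True
    show ?thesis using th_ge[OF w True] fpos[OF w True] by (simp add: field_simps)
  next
    case ng: False
    show ?thesis
    proof (cases "f w < 0")
      case True
      have "\<theta> * (- f w) \<le> g w"
        using th_le[OF w True] True by (subst (asm) pos_le_divide_eq) auto
      then show ?thesis by simp
    next
      case False
      then show ?thesis using ng th0 by simp
    qed
  qed
  show ?thesis
  proof (intro bexI[of _ "1 / (1 + \<theta>)"] ballI)
    fix w assume "w \<in> K"
    have e: "1 - 1 / (1 + \<theta>) = \<theta> / (1 + \<theta>)" using th0 by (simp add: field_simps)
    have "(1 - 1 / (1 + \<theta>)) * f w + 1 / (1 + \<theta>) * g w = (\<theta> * f w + g w) / (1 + \<theta>)"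
      using th0 by (simp add: e add_divide_distrib)
    then show "0 \<le> (1 - 1 / (1 + \<theta>)) * f w + 1 / (1 + \<theta>) * g w"
      using main[OF \<open>w \<in> K\<close>] th0 by simp
  qed (use th0 in auto)
qed

text \<open>
  The set where the new function \<open>f i\<close> is negative is convex, and on it the other functions already
  satisfy the hypothesis. The combination that they provide there, paired with \<open>f i\<close>, satisfies the
  two-function alternative on all of \<open>K\<close>.
\<close>

lemma convex_alternative:
  fixes f :: "'i \<Rightarrow> 'a::real_vector \<Rightarrow> real"
  assumes "finite I" "I \<noteq> {}" "convex K" "\<And>i. i \<in> I \<Longrightarrow> convex_on K (f i)"
    and "\<And>w. w \<in> K \<Longrightarrow> \<exists>i\<in>I. 0 \<le> f i w"
  shows "\<exists>l. (\<forall>i\<in>I. 0 \<le> l i) \<and> sum l I = (1::real) \<and> (\<forall>w\<in>K. 0 \<le> (\<Sum>i\<in>I. l i * f i w))"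
  using assms
proof (induction I arbitrary: K rule: finite_ne_induct)
  case (singleton i)
  then show ?case by (intro exI[of _ "\<lambda>_. 1"]) auto
next
  case (insert i I)
  define K' where "K' = {w \<in> K. f i w < 0}"
  have fi: "convex_on K (f i)" using insert.prems by auto
  have K': "convex K'" unfolding convex_alt
  proof (intro ballI allI impI)
    fix u v t assume u: "u \<in> K'" and v: "v \<in> K'" and t: "0 \<le> t \<and> t \<le> (1::real)"
    have "f i ((1 - t) *\<^sub>R u + t *\<^sub>R v) \<le> (1 - t) * f i u + t * f i v"
      using convex_onD[OF fi] t u v unfolding K'_def by auto
    also have "\<dots> < 0"
      using convex_bound_lt[of "f i u" 0 "f i v" "1 - t" t] t u v unfolding K'_def by auto
    finally show "(1 - t) *\<^sub>R u + t *\<^sub>R v \<in> K'"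
      using t u v \<open>convex K\<close> unfolding K'_def convex_alt by auto
  qed
  have sub: "K' \<subseteq> K" unfolding K'_def by auto
  have "\<exists>l. (\<forall>i\<in>I. 0 \<le> l i) \<and> sum l I = (1::real) \<and> (\<forall>w\<in>K'. 0 \<le> (\<Sum>i\<in>I. l i * f i w))"
  proof (rule insert.IH[OF K'])
    show "convex_on K' (f j)" if "j \<in> I" for j
      using insert.prems(2)[of j] that sub K' by (auto intro: convex_on_subset)
    show "\<exists>j\<in>I. 0 \<le> f j w" if "w \<in> K'" for w
      using insert.prems(3)[of w] that unfolding K'_def by auto
  qed
  then obtain l where l: "\<forall>i\<in>I. 0 \<le> l i" "sum l I = (1::real)"
    "\<forall>w\<in>K'. 0 \<le> (\<Sum>i\<in>I. l i * f i w)" by blast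
  define g where "g w = (\<Sum>i\<in>I. l i * f i w)" for w
  have g: "convex_on K g" unfolding g_def
    using \<open>finite I\<close> l(1) insert.prems(1,2)
  proof (induction I rule: finite_induct)
    case empty
    then show ?case by (simp add: convex_on_const)
  next
    case (insert j J)
    then have "convex_on K (\<lambda>w. l j * f j w)" by (intro convex_on_cmul) auto
    then show ?case using insert by (auto intro!: convex_on_add)
  qed
  have "0 \<le> f i w \<or> 0 \<le> g w" if "w \<in> K" for w
    using that l(3) unfolding K'_def g_def by force
  from convex_alternative_two[OF fi g this] obtain t where
    t: "t \<in> {0..1}" "\<forall>w\<in>K. 0 \<le> (1 - t) * f i w + t * g w" by blast
  define m where "m j = (if j = i then 1 - t else t * l j)" for j
  have s: "(\<Sum>j\<in>I. m j * F j) = t * (\<Sum>j\<in>I. l j * F j)" for F :: "'i \<Rightarrow> real"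
    unfolding sum_distrib_left by (rule sum.cong) (use insert.hyps in \<open>auto simp: m_def\<close>)
  show ?case
  proof (intro exI[of _ m] conjI ballI)
    show "0 \<le> m j" if "j \<in> insert i I" for j using that t l unfolding m_def by auto
    show "sum m (insert i I) = 1" using insert.hyps s[of "\<lambda>_. 1"] l by (simp add: m_def)
    show "0 \<le> (\<Sum>j\<in>insert i I. m j * f j w)" if "w \<in> K" for w
      using that t insert.hyps s[of "\<lambda>j. f j w"] by (simp add: m_def g_def)
  qed
qed

section \<open>Functions with common approximate subgradients\<close>

text \<open>
  On a grid of mesh \<open>1/n\<close>, the slope at the left end of a cell bounds the increment of \<open>f\<close> from below
  and the slope at the right end bounds that of \<open>g\<close> from above. Each grid point has one slope for both
  functions, so the differences of neighbouring slopes telescope and the total discrepancy is of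
  order \<open>1/n\<close>. Exact subgradients at the two ends keep the telescoped slopes independent of \<open>n\<close>.
\<close>

lemma increment_le_if_common_subgradients:
  fixes f g :: "real \<Rightarrow> real"
  assumes approx: "\<And>t e. t \<in> {0..1} \<Longrightarrow> 0 < e \<Longrightarrow>
      \<exists>b. \<forall>s\<in>{0..1}. f t + b * (s - t) - e \<le> f s \<and> g t + b * (s - t) - e \<le> g s"
    and left: "\<And>s. s \<in> {0..1} \<Longrightarrow> f 0 + b0 * s \<le> f s \<and> g 0 + b0 * s \<le> g s"
    and right: "\<And>s. s \<in> {0..1} \<Longrightarrow> f 1 + b1 * (s - 1) \<le> f s \<and> g 1 + b1 * (s - 1) \<le> g s"
  shows "g 1 - g 0 \<le> f 1 - f 0"
proof -
  have bound: "(g 1 - g 0) - (f 1 - f 0) \<le> (b1 - b0 + 2) / real n" if n: "n > 0" for n :: nat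
  proof -
    \<comment> \<open>Small enough for the \<open>n\<close> errors to add up to something of order \<open>1/n\<close>.\<close>
    define e where "e = 1 / (real n)^2"
    have e: "0 < e" using n by (simp add: e_def)
    define t where "t i = real i / real n" for i
    have tI: "t i \<in> {0..1}" if "i \<le> n" for i using that n by (auto simp: t_def)
    have "\<exists>b. \<forall>s\<in>{0..1}. f (t i) + b * (s - t i) - e \<le> f s \<and> g (t i) + b * (s - t i) - e \<le> g s"
      if "i \<le> n" for i by (rule approx) (use tI that e in auto)
    then obtain \<beta>' where \<beta>': "\<And>i s. i \<le> n \<Longrightarrow> s \<in> {0..1} \<Longrightarrow>
        f (t i) + \<beta>' i * (s - t i) - e \<le> f s \<and> g (t i) + \<beta>' i * (s - t i) - e \<le> g s"
      by metis
    define \<beta> where "\<beta> i = (if i = 0 then b0 else if i = n then b1 else \<beta>' i)" for i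
    have t0: "t 0 = 0" and tn: "t n = 1" using n by (auto simp: t_def)
    have \<beta>: "f (t i) + \<beta> i * (s - t i) - e \<le> f s \<and> g (t i) + \<beta> i * (s - t i) - e \<le> g s"
      if "i \<le> n" "s \<in> {0..1}" for i s
      using \<beta>'[OF that] left[OF that(2)] right[OF that(2)] e t0 tn n
      by (cases "i = 0"; cases "i = n") (auto simp: \<beta>_def)
    have st: "t (Suc i) - t i = 1 / real n" for i
      by (simp add: t_def diff_divide_distrib[symmetric])
    have step: "(g (t (Suc i)) - g (t i)) - (f (t (Suc i)) - f (t i))
        \<le> (\<beta> (Suc i) - \<beta> i) / real n + 2 * e" if i: "i < n" for i
    proof -
      have 1: "f (t i) + \<beta> i * (1 / real n) - e \<le> f (t (Suc i))"
        using \<beta>[of i "t (Suc i)"] tI[of "Suc i"] i st[of i] by auto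
      have "t i - t (Suc i) = - (1 / real n)" using st[of i] by simp
      then have 2: "g (t (Suc i)) + \<beta> (Suc i) * (- (1 / real n)) - e \<le> g (t i)"
        using \<beta>[of "Suc i" "t i"] tI[of i] i by auto
      show ?thesis using 1 2 by (simp add: diff_divide_distrib)
    qed
    have "(g 1 - g 0) - (f 1 - f 0)
        = (\<Sum>i<n. (g (t (Suc i)) - g (t i)) - (f (t (Suc i)) - f (t i)))"
      using sum_lessThan_telescope[of "\<lambda>i. g (t i)" n] sum_lessThan_telescope[of "\<lambda>i. f (t i)" n] t0 tn
      by (simp add: sum_subtractf)
    also have "\<dots> \<le> (\<Sum>i<n. (\<beta> (Suc i) - \<beta> i) / real n + 2 * e)"
      by (rule sum_mono) (use step in auto)
    also have "\<dots> = (b1 - b0) / real n + real n * (2 * e)"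
      using sum_lessThan_telescope[of \<beta> n] n
      by (simp add: sum.distrib sum_divide_distrib[symmetric] \<beta>_def)
    also have "\<dots> = (b1 - b0 + 2) / real n"
      using n by (simp add: e_def power2_eq_square field_simps)
    finally show ?thesis .
  qed
  have "(\<lambda>n. (b1 - b0 + 2) / real n) \<longlonglongrightarrow> 0" by (rule lim_const_over_n)
  then have "(g 1 - g 0) - (f 1 - f 0) \<le> 0"
    by (rule LIMSEQ_le_const) (use bound in \<open>auto intro!: exI[of _ 1]\<close>)
  then show ?thesis by simp
qed

section \<open>Lower semicontinuous convex functions on a dual system\<close>

lemma in_Graph_subdifferential_iff:
  "(a, b) \<in> Graph (subdifferential c g) \<longleftrightarrow>
     (\<exists>r. g a = ereal r \<and> (\<forall>w. ereal (r + c (w - a) b) \<le> g w))"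
  by (cases "g a") (auto simp: Graph_def subdifferential_def add.commute)

lemma Graph_inject: "Graph S = Graph T \<Longrightarrow> S = T"
  by (fastforce simp: Graph_def fun_eq_iff)

locale dual_system =
  fixes c :: "'a::real_vector \<Rightarrow> 'b::real_vector \<Rightarrow> real"
  assumes bilinear: "bilinear c"
begin

lemmas pairing_simps =
  bilinear_ladd[OF bilinear] bilinear_radd[OF bilinear]
  bilinear_lsub[OF bilinear] bilinear_rsub[OF bilinear]
  bilinear_lneg[OF bilinear] bilinear_rneg[OF bilinear]
  bilinear_lmul[OF bilinear] bilinear_rmul[OF bilinear]
  bilinear_lzero[OF bilinear] bilinear_rzero[OF bilinear]

lemma pairing_sum_right: "c x (\<Sum>i\<in>I. f i) = (\<Sum>i\<in>I. c x (f i))"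
  by (rule linear_sum) (use bilinear in \<open>simp add: bilinear_def\<close>)

lemma topspace_sigma [simp]: "topspace (sigma_topology c) = UNIV"
proof -
  have "(\<lambda>x. c x 0) -` UNIV \<in> {(\<lambda>x. c x y) -` U | y U. open U}" by blast
  then show ?thesis by (auto simp: sigma_topology_def)
qed

lemma sigma_open_nbhd:
  assumes "openin (sigma_topology c) U" and "x \<in> U"
  shows "\<exists>F e. finite F \<and> 0 < e \<and> (\<forall>w. (\<forall>y\<in>F. c (w - x) y < e) \<longrightarrow> w \<in> U)"
proof -
  have "generate_topology_on {(\<lambda>x. c x y) -` U | y U. open U} U"
    using assms(1) by (simp add: sigma_topology_def openin_topology_generated_by_iff)
  then show ?thesis using assms(2)
  proof (induction)
    case Empty
    then show ?case by simp
  next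
    case (Int a b)
    then obtain F e F' e' where *: "finite F" "0 < e" "\<forall>w. (\<forall>y\<in>F. c (w - x) y < e) \<longrightarrow> w \<in> a"
      "finite F'" "0 < e'" "\<forall>w. (\<forall>y\<in>F'. c (w - x) y < e') \<longrightarrow> w \<in> b"
      by auto
    then show ?case by (intro exI[of _ "F \<union> F'"] exI[of _ "min e e'"]) auto
  next
    case (UN K)
    then obtain k where "k \<in> K" "x \<in> k" by auto
    with UN.IH[OF this] show ?case by blast
  next
    case (Basis s)
    then obtain y V where s: "s = (\<lambda>x. c x y) -` V" "open V" by auto
    then obtain e where e: "0 < e" "\<And>r. dist r (c x y) < e \<Longrightarrow> r \<in> V"
      using Basis.prems by (auto simp: open_dist)
    \<comment> \<open>Including \<open>- y\<close> turns a two-sided bound into the one-sided bounds of the statement.\<close>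
    show ?case
    proof (intro exI[of _ "{y, - y}"] exI[of _ e] conjI allI impI)
      fix w assume "\<forall>z\<in>{y, - y}. c (w - x) z < e"
      then have "dist (c w y) (c x y) < e" by (auto simp: dist_real_def pairing_simps abs_less_iff)
      then show "w \<in> s" using e s by simp
    qed (use e in auto)
  qed
qed

lemma lsc_nbhd:
  assumes "g \<in> Gamma_sigma c" and "ereal r < g x"
  shows "\<exists>F e. finite F \<and> 0 < e \<and> (\<forall>w. (\<forall>y\<in>F. c (w - x) y < e) \<longrightarrow> ereal r < g w)"
proof -
  have "openin (sigma_topology c) {w. ereal r < g w}"
    using assms(1) by (simp add: Gamma_sigma_def lsc_fun_def)
  from sigma_open_nbhd[OF this, of x] assms(2) show ?thesis by auto
qed

text \<open>
  Affine functions with slope in the dual space are continuous for \<open>\<sigma>(X,Y)\<close>, and convexity and lower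
  semicontinuity pass to suprema. This is how all potentials below are seen to be admissible.
\<close>

lemma affine_sup_in_Gamma:
  assumes ne: "A \<noteq> {}" and fin: "g x0 \<noteq> \<infinity>"
    and g: "\<And>w. g w = (SUP (b, \<beta>)\<in>A. ereal (c w b + \<beta>))"
  shows "g \<in> Gamma_sigma c"
proof -
  have ge: "ereal (c w b + \<beta>) \<le> g w" if "(b, \<beta>) \<in> A" for w b \<beta>
    unfolding g using that by (intro SUP_upper2[of "(b, \<beta>)"]) auto
  obtain b0 \<beta>0 where b0: "(b0, \<beta>0) \<in> A" using ne by auto
  have "g w \<noteq> -\<infinity>" for w using ge[OF b0, of w] by auto
  then have "proper_fun g" using fin by (auto simp: proper_fun_def)
  moreover have "convex_fun g"
    unfolding convex_fun_def
  proof (intro allI ballI)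
    fix x y :: 'a and t :: real assume t: "t \<in> {0<..<1}"
    let ?z = "(1 - t) *\<^sub>R x + t *\<^sub>R y"
    show "g ?z \<le> ereal (1 - t) * g x + ereal t * g y"
      unfolding g[of ?z]
    proof (rule SUP_least, clarify)
      fix b \<beta> assume b: "(b, \<beta>) \<in> A"
      have "c ?z b + \<beta> = (1 - t) * (c x b + \<beta>) + t * (c y b + \<beta>)"
        by (simp add: pairing_simps algebra_simps)
      then have "ereal (c ?z b + \<beta>) = ereal (1 - t) * ereal (c x b + \<beta>) + ereal t * ereal (c y b + \<beta>)"
        by simp
      also have "\<dots> \<le> ereal (1 - t) * g x + ereal t * g y"
        using t by (intro add_mono ereal_mult_left_mono ge[OF b]) auto
      finally show "ereal (c ?z b + \<beta>) \<le> ereal (1 - t) * g x + ereal t * g y" .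
    qed
  qed
  moreover have "lsc_fun (sigma_topology c) g"
    unfolding lsc_fun_def
  proof
    fix r :: ereal
    have "{w \<in> topspace (sigma_topology c). r < g w}
        = (\<Union>(b, \<beta>)\<in>A. (\<lambda>w. c w b) -` {s. r < ereal (s + \<beta>)})"
      by (force simp: g less_SUP_iff)
    moreover have "openin (sigma_topology c) ((\<lambda>w. c w b) -` {s. r < ereal (s + \<beta>)})" for b \<beta>
    proof -
      have "open {s. r < ereal (s + \<beta>)}"
        by (intro open_Collect_less continuous_intros)
      then show ?thesis unfolding sigma_topology_def
        by (intro topology_generated_by_Basis) blast
    qed
    ultimately show "openin (sigma_topology c) {w \<in> topspace (sigma_topology c). r < g w}"
      by auto
  qed
  ultimately show ?thesis by (simp add: Gamma_sigma_def)
qed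

lemma Gamma_domain_convex:
  assumes "g \<in> Gamma_sigma c"
  shows "convex_on {w. g w \<noteq> \<infinity>} (\<lambda>w. real_of_ereal (g w))"
proof -
  have fin: "g w \<noteq> -\<infinity>" for w using assms by (auto simp: Gamma_sigma_def proper_fun_def)
  have *: "g ((1 - t) *\<^sub>R u + t *\<^sub>R v) \<le> ereal ((1 - t) * real_of_ereal (g u) + t * real_of_ereal (g v))"
    if "g u \<noteq> \<infinity>" "g v \<noteq> \<infinity>" "0 < t" "t < 1" for u v t
  proof -
    have "g ((1 - t) *\<^sub>R u + t *\<^sub>R v) \<le> ereal (1 - t) * g u + ereal t * g v"
      using assms that by (auto simp: Gamma_sigma_def convex_fun_def)
    then show ?thesis using that fin[of u] fin[of v] by (cases "g u"; cases "g v") auto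
  qed
  have cv: "convex {w. g w \<noteq> \<infinity>}"
    unfolding convex_alt
  proof (intro ballI allI impI)
    fix u v t assume "u \<in> {w. g w \<noteq> \<infinity>}" "v \<in> {w. g w \<noteq> \<infinity>}" and "0 \<le> t \<and> t \<le> (1::real)"
    then show "(1 - t) *\<^sub>R u + t *\<^sub>R v \<in> {w. g w \<noteq> \<infinity>}"
      using *[of u v t] by (cases "t = 0"; cases "t = 1") auto
  qed
  show ?thesis
  proof (rule convex_onI)
    fix t u v assume t: "(0::real) < t" "t < 1" and uv: "u \<in> {w. g w \<noteq> \<infinity>}" "v \<in> {w. g w \<noteq> \<infinity>}"
    show "real_of_ereal (g ((1 - t) *\<^sub>R u + t *\<^sub>R v))
        \<le> (1 - t) * real_of_ereal (g u) + t * real_of_ereal (g v)"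
      using *[of u v t] uv t fin[of "(1 - t) *\<^sub>R u + t *\<^sub>R v"]
      by (cases "g ((1 - t) *\<^sub>R u + t *\<^sub>R v)") auto
  qed (rule cv)
qed

text \<open>
  The duality theorem of Fenchel and Moreau at one point. On the domain of \<open>g\<close>, one of the functions
  \<open>g - r\<close> and \<open>w \<mapsto> c (w - x) y - e\<close>, for \<open>y\<close> in a finite set describing a neighbourhood of \<open>x\<close>, is
  always nonnegative; the theorem of the alternative gives a nonnegative combination. If \<open>g - r\<close>
  occurs in it, dividing by its weight gives the affine minorant. Otherwise the combination is a
  functional that separates \<open>x\<close> strictly from the domain, and a large multiple of it is added to
  the affine minorant given by the subgradient.
\<close>

lemma affine_minorant_below:
  assumes g: "g \<in> Gamma_sigma c" and sub: "(a, b) \<in> Graph (subdifferential c g)"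
    and r: "ereal r < g x"
  shows "\<exists>y. \<forall>w. ereal (r + c (w - x) y) \<le> g w"
proof -
  obtain F e where F: "finite F" "0 < e"
    and nb: "\<And>w. (\<forall>y\<in>F. c (w - x) y < e) \<Longrightarrow> ereal r < g w"
    using lsc_nbhd[OF g r] by auto
  define K where "K = {w. g w \<noteq> \<infinity>}"
  define G where "G w = real_of_ereal (g w)" for w
  have fin: "g w \<noteq> -\<infinity>" for w using g by (auto simp: Gamma_sigma_def proper_fun_def)
  have gG: "g w = ereal (G w)" if "w \<in> K" for w
    using that fin[of w] by (cases "g w") (auto simp: K_def G_def)
  have GK: "convex_on K G" using Gamma_domain_convex[OF g] unfolding K_def G_def .
  then have K: "convex K" by (rule convex_on_imp_convex)
  \<comment> \<open>\<open>None\<close> indexes the function itself and \<open>Some y\<close> the functional given by \<open>y\<close>.\<close>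
  define f where "f i w = (case i of None \<Rightarrow> G w - r | Some y \<Rightarrow> c (w - x) y - e)" for i w
  have aff: "convex_on K (\<lambda>w. c (w - x) y - e)" for y
  proof (rule convex_onI)
    fix t u v assume "(0::real) < t" "t < 1"
    have "c ((1 - t) *\<^sub>R u + t *\<^sub>R v - x) y - e
        = (1 - t) * (c (u - x) y - e) + t * (c (v - x) y - e)"
      by (simp add: pairing_simps algebra_simps)
    then show "c ((1 - t) *\<^sub>R u + t *\<^sub>R v - x) y - e
        \<le> (1 - t) * (c (u - x) y - e) + t * (c (v - x) y - e)" by simp
  qed (rule K)
  have "\<exists>l. (\<forall>i\<in>insert None (Some ` F). 0 \<le> l i) \<and> sum l (insert None (Some ` F)) = (1::real)
      \<and> (\<forall>w\<in>K. 0 \<le> (\<Sum>i\<in>insert None (Some ` F). l i * f i w))"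
  proof (rule convex_alternative)
    show "convex_on K (f i)" for i
    proof (cases i)
      case None
      have "convex_on K (\<lambda>w. G w + - r)" by (intro convex_on_add GK) (simp add: convex_on_const K)
      then show ?thesis by (simp add: f_def[abs_def] None)
    next
      case (Some y)
      then show ?thesis using aff by (simp add: f_def[abs_def])
    qed
    show "\<exists>i\<in>insert None (Some ` F). 0 \<le> f i w" if "w \<in> K" for w
    proof (cases "\<forall>y\<in>F. c (w - x) y < e")
      case True
      then show ?thesis using nb[OF True] gG[OF that] by (auto simp: f_def)
    next
      case False
      then show ?thesis by (force simp: f_def not_less)
    qed
  qed (use F K in auto)
  then obtain l where l: "\<forall>i\<in>insert None (Some ` F). 0 \<le> l i"
    "sum l (insert None (Some ` F)) = (1::real)"
    "\<forall>w\<in>K. 0 \<le> (\<Sum>i\<in>insert None (Some ` F). l i * f i w)" by blast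
  define p where "p = l None"
  define z where "z = (\<Sum>y\<in>F. l (Some y) *\<^sub>R y)"
  have sumF: "(\<Sum>i\<in>Some ` F. h i) = (\<Sum>y\<in>F. h (Some y))" for h :: "'b option \<Rightarrow> real"
    by (simp add: sum.reindex)
  have wts: "(\<Sum>y\<in>F. l (Some y)) = 1 - p"
    using l(2) F by (simp add: sumF p_def)
  have p0: "0 \<le> p" using l by (simp add: p_def)
  have p1: "0 \<le> 1 - p" unfolding wts[symmetric] using l by (intro sum_nonneg) auto
  have main: "0 \<le> p * (G w - r) + c (w - x) z - (1 - p) * e" if "w \<in> K" for w
  proof -
    have "(\<Sum>y\<in>F. l (Some y) * (c (w - x) y - e)) = c (w - x) z - (1 - p) * e"
      by (simp add: z_def pairing_sum_right bilinear_rmul[OF bilinear] right_diff_distrib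
          sum_subtractf wts[symmetric] sum_distrib_right)
    moreover have "0 \<le> p * (G w - r) + (\<Sum>y\<in>F. l (Some y) * (c (w - x) y - e))"
      using l(3) that F by (simp add: sumF f_def p_def)
    ultimately show ?thesis by linarith
  qed
  have reduce: ?thesis if "\<And>w. w \<in> K \<Longrightarrow> r + c (w - x) y \<le> G w" for y
    using that gG by (intro exI[of _ y]) (metis (mono_tags) K_def ereal_less_eq(1) ereal_less_eq(3) mem_Collect_eq)
  show ?thesis
  proof (cases "p = 0")
    case False
    then have p: "0 < p" using p0 by simp
    show ?thesis
    proof (rule reduce)
      fix w assume "w \<in> K"
      from main[OF this] have "0 \<le> p * (G w - r) + c (w - x) z"
        using p1 F by (smt (verit) mult_nonneg_nonneg)
      then have "0 \<le> (p * (G w - r) + c (w - x) z) / p" using p by simp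
      also have "\<dots> = G w - r + c (w - x) z / p" using p by (simp add: add_divide_distrib)
      finally show "r + c (w - x) ((- 1 / p) *\<^sub>R z) \<le> G w"
        by (simp add: bilinear_rmul[OF bilinear] bilinear_rneg[OF bilinear])
    qed
  next
    case True
    obtain s where s: "\<And>w. ereal (s + c (w - a) b) \<le> g w"
      using sub by (auto simp: in_Graph_subdifferential_iff)
    define r0 where "r0 = s + c (x - a) b"
    define M where "M = max 0 ((r - r0) / e)"
    have M: "0 \<le> M" "r - r0 \<le> M * e"
      unfolding M_def using F by (auto simp: pos_divide_le_eq[symmetric])
    show ?thesis
    proof (rule reduce)
      fix w assume w: "w \<in> K"
      have "e \<le> c (w - x) z" using main[OF w] True by simp
      then have 1: "M * e \<le> M * c (w - x) z" using M by (intro mult_left_mono)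
      have "s + c (w - a) b \<le> G w" using s[of w] gG[OF w] by simp
      moreover have "c (w - a) b = c (w - x) b + c (x - a) b" by (simp add: pairing_simps)
      ultimately show "r + c (w - x) (b - M *\<^sub>R z) \<le> G w"
        using 1 M unfolding bilinear_rsub[OF bilinear] bilinear_rmul[OF bilinear] r0_def by simp
    qed
  qed
qed

end

section \<open>Chains and their affine functions\<close>

text \<open>
  Following a chain \<open>(x\<^sub>1, y\<^sub>1), \<dots>, (x\<^sub>n, y\<^sub>n)\<close> of the graph from a starting point \<open>w\<close> costs
  \<open>\<langle>w - x\<^sub>1, y\<^sub>1\<rangle> + \<Sum>\<^bsub>i\<ge>2\<^esub> \<langle>x\<^bsub>i-1\<^esub> - x\<^sub>i, y\<^sub>i\<rangle>\<close>, an affine function of \<open>w\<close>. The predicate records its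
  slope \<open>b = y\<^sub>1\<close>, its constant term \<open>\<beta>\<close> and the end point \<open>a = x\<^sub>n\<close>, which is all that the arguments
  below use; chains grow at their starting end.
\<close>

inductive chain_affine ::
  "('a::real_vector \<Rightarrow> 'b::real_vector \<Rightarrow> real) \<Rightarrow> ('a \<Rightarrow> 'b set) \<Rightarrow> 'a \<Rightarrow> 'b \<Rightarrow> real \<Rightarrow> bool"
  for c T where
  single: "(a, b) \<in> Graph T \<Longrightarrow> chain_affine c T a b (- c a b)"
| step: "(p, q) \<in> Graph T \<Longrightarrow> chain_affine c T a b \<beta> \<Longrightarrow>
    chain_affine c T a q (c p b + \<beta> - c p q)"

lemma chain_affine_mono:
  assumes "chain_affine c S a b \<beta>" and "Graph S \<subseteq> Graph T"
  shows "chain_affine c T a b \<beta>"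
  using assms by induction (auto intro: chain_affine.intros)

text \<open>
  No chain from \<open>x\<close> has a positive value when \<open>(x, y)\<close> leads back from its end point to \<open>x\<close>. When
  \<open>T\<close> is cyclically monotone, this says that adding \<open>(x, y)\<close> to its graph preserves cyclic
  monotonicity.
\<close>

definition joinable ::
  "('a::real_vector \<Rightarrow> 'b::real_vector \<Rightarrow> real) \<Rightarrow> ('a \<Rightarrow> 'b set) \<Rightarrow> 'a \<Rightarrow> 'b \<Rightarrow> bool" where
  "joinable c T x y \<longleftrightarrow> (\<forall>a b \<beta>. chain_affine c T a b \<beta> \<longrightarrow> c x b + \<beta> + c (a - x) y \<le> 0)"

context dual_system
begin

lemma chain_affine_of_sequence:
  fixes xs :: "nat \<Rightarrow> 'a" and ys :: "nat \<Rightarrow> 'b"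
  assumes "1 \<le> n" and "\<forall>i\<in>{1..n}. (xs i, ys i) \<in> Graph T"
  shows "chain_affine c T (xs n) (ys 1)
    ((\<Sum>i=2..n. c (xs (i - 1) - xs i) (ys i)) - c (xs 1) (ys 1))"
  using assms
proof (induction n arbitrary: xs ys rule: dec_induct)
  case base
  then show ?case by (auto intro: chain_affine.single)
next
  case (step n)
  let ?xs = "\<lambda>i. xs (Suc i)" and ?ys = "\<lambda>i. ys (Suc i)"
  have "chain_affine c T (?xs n) (?ys 1)
    ((\<Sum>i=2..n. c (?xs (i - 1) - ?xs i) (?ys i)) - c (?xs 1) (?ys 1))"
    by (rule step.IH) (use step.prems in auto)
  from chain_affine.step[OF _ this, of "xs 1" "ys 1"] step.prems
  have *: "chain_affine c T (xs (Suc n)) (ys 1)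
    (c (xs 1) (?ys 1) + ((\<Sum>i=2..n. c (?xs (i - 1) - ?xs i) (?ys i)) - c (?xs 1) (?ys 1))
      - c (xs 1) (ys 1))" by auto
  have sum: "(\<Sum>i=2..Suc n. c (xs (i - 1) - xs i) (ys i))
      = c (xs 1 - xs 2) (ys 2) + (\<Sum>i=2..n. c (?xs (i - 1) - ?xs i) (?ys i))"
  proof -
    have "(\<Sum>i=2..Suc n. c (xs (i - 1) - xs i) (ys i))
        = c (xs 1 - xs 2) (ys 2) + (\<Sum>i=Suc 2..Suc n. c (xs (i - 1) - xs i) (ys i))"
      using step.hyps by (subst sum.atLeast_Suc_atMost) auto
    also have "(\<Sum>i=Suc 2..Suc n. c (xs (i - 1) - xs i) (ys i))
        = (\<Sum>i=2..n. c (xs (Suc i - 1) - xs (Suc i)) (ys (Suc i)))"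
      by (rule sum.shift_bounds_cl_Suc_ivl)
    also have "\<dots> = (\<Sum>i=2..n. c (?xs (i - 1) - ?xs i) (?ys i))"
      by (rule sum.cong) auto
    finally show ?thesis .
  qed
  have "c (xs 1) (?ys 1) + ((\<Sum>i=2..n. c (?xs (i - 1) - ?xs i) (?ys i)) - c (?xs 1) (?ys 1))
      - c (xs 1) (ys 1) = (\<Sum>i=2..Suc n. c (xs (i - 1) - xs i) (ys i)) - c (xs 1) (ys 1)"
    unfolding sum by (simp add: bilinear_lsub[OF bilinear] numeral_2_eq_2)
  then show ?case using * by (simp only:)
qed

lemma chain_affine_sequence:
  assumes "chain_affine c T a b \<beta>"
  shows "\<exists>n\<ge>1. \<exists>(xs :: nat \<Rightarrow> 'a) (ys :: nat \<Rightarrow> 'b). (\<forall>i\<in>{1..n}. (xs i, ys i) \<in> Graph T) \<and> xs n = a \<and> ys 1 = b \<and>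
    (\<Sum>i=2..n. c (xs (i - 1) - xs i) (ys i)) - c (xs 1) (ys 1) = \<beta>"
  using assms
proof induction
  case (single a b)
  then show ?case by (intro exI[of _ 1] conjI exI[of _ "\<lambda>_. a"] exI[of _ "\<lambda>_. b"]) auto
next
  case (step p q a b \<beta>)
  then obtain n :: nat and xs ys where n: "1 \<le> n" "\<forall>i\<in>{1..n}. (xs i, ys i) \<in> Graph T" "xs n = a" "ys 1 = b"
    "(\<Sum>i=2..n. c (xs (i - 1) - xs i) (ys i)) - c (xs 1) (ys 1) = \<beta>" by blast
  define us where "us i = (if i = 1 then p else xs (i - 1))" for i
  define vs where "vs i = (if i = 1 then q else ys (i - 1))" for i
  have "(\<Sum>i=2..Suc n. c (us (i - 1) - us i) (vs i))
      = c (us 1 - us 2) (vs 2) + (\<Sum>i=Suc 2..Suc n. c (us (i - 1) - us i) (vs i))"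
    using n by (subst sum.atLeast_Suc_atMost) auto
  also have "(\<Sum>i=Suc 2..Suc n. c (us (i - 1) - us i) (vs i))
      = (\<Sum>i=2..n. c (us (Suc i - 1) - us (Suc i)) (vs (Suc i)))"
    by (rule sum.shift_bounds_cl_Suc_ivl)
  also have "\<dots> = (\<Sum>i=2..n. c (xs (i - 1) - xs i) (ys i))"
    by (rule sum.cong) (auto simp: us_def vs_def)
  finally have sum: "(\<Sum>i=2..Suc n. c (us (i - 1) - us i) (vs i))
      = c (p - xs 1) (ys 1) + (\<Sum>i=2..n. c (xs (i - 1) - xs i) (ys i))"
    by (simp add: us_def vs_def)
  show ?case
  proof (intro exI[of _ "Suc n"] conjI exI[of _ us] exI[of _ vs])
    show "\<forall>i\<in>{1..Suc n}. (us i, vs i) \<in> Graph T"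
    proof
      fix i assume i: "i \<in> {1..Suc n}"
      show "(us i, vs i) \<in> Graph T"
      proof (cases "i = 1")
        case False
        then have "i - 1 \<in> {1..n}" using i by auto
        then show ?thesis using n(2) False by (simp add: us_def vs_def)
      qed (use step.hyps(1) in \<open>simp add: us_def vs_def\<close>)
    qed
    show "us (Suc n) = a" using n by (simp add: us_def)
    show "vs 1 = q" by (simp add: vs_def)
    show "(\<Sum>i=2..Suc n. c (us (i - 1) - us i) (vs i)) - c (us 1) (vs 1) = c p b + \<beta> - c p q"
      unfolding sum using n by (simp add: us_def vs_def pairing_simps)
  qed simp
qed

text \<open>
  A cycle through \<open>(x, y)\<close> is a chain from \<open>x\<close> closed up by \<open>(x, y)\<close>. Cycles in the definition of
  cyclic monotonicity run in the direction opposite to chains, so indices are reversed and the sign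
  of the sum changes.
\<close>

lemma cyclically_monotone_iff_joinable:
  "cyclically_monotone c T \<longleftrightarrow> (\<forall>(x, y)\<in>Graph T. joinable c T x y)"
proof
  assume T: "cyclically_monotone c T"
  show "\<forall>(x, y)\<in>Graph T. joinable c T x y"
    unfolding joinable_def
  proof (clarify)
    fix x y a b \<beta> assume xy: "(x, y) \<in> Graph T" and "chain_affine c T a b \<beta>"
    from chain_affine_sequence[OF this(2)] obtain n :: nat and xs ys where n: "1 \<le> n"
      "\<forall>i\<in>{1..n}. (xs i, ys i) \<in> Graph T" "xs n = a" "ys 1 = b"
      "(\<Sum>i=2..n. c (xs (i - 1) - xs i) (ys i)) - c (xs 1) (ys 1) = \<beta>" by blast
    define us where "us i = (if i = 1 \<or> i = n + 2 then x else xs (n + 2 - i))" for i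
    define vs where "vs i = (if i = 1 then y else ys (n + 2 - i))" for i
    have in_T: "(us i, vs i) \<in> Graph T" if "i \<in> {1..n + 1}" for i
    proof (cases "i = 1")
      case False
      then have "n + 2 - i \<in> {1..n}" using that by auto
      then show ?thesis using n(2) that False by (auto simp: us_def vs_def)
    qed (use xy in \<open>simp add: us_def vs_def\<close>)
    have "0 \<le> (\<Sum>i=1..n + 1. c (us i - us (i + 1)) (vs i))"
      using T[unfolded cyclically_monotone_def, rule_format, of "n + 1" us vs] in_T n(1)
      by (auto simp: us_def)
    also have "(\<Sum>i=1..n + 1. c (us i - us (i + 1)) (vs i))
        = c (x - a) y + (\<Sum>i=2..n + 1. c (us i - us (i + 1)) (vs i))"
      using n(1,3) by (subst sum.atLeast_Suc_atMost) (auto simp: us_def vs_def numeral_2_eq_2)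
    also have "(\<Sum>i=2..n + 1. c (us i - us (i + 1)) (vs i))
        = (\<Sum>i=2..n. c (us i - us (i + 1)) (vs i)) + c (xs 1 - x) b"
      using n(1,4) by (simp add: us_def vs_def)
    also have "(\<Sum>i=2..n. c (us i - us (i + 1)) (vs i)) = (\<Sum>i=2..n. - c (xs (i - 1) - xs i) (ys i))"
    proof (rule sum.reindex_bij_witness[where i = "\<lambda>i. n + 2 - i" and j = "\<lambda>i. n + 2 - i"])
      fix i assume i: "i \<in> {2..n}"
      have "n + 2 - (i + 1) = n + 2 - i - 1" by simp
      then show "- c (xs (n + 2 - i - 1) - xs (n + 2 - i)) (ys (n + 2 - i))
          = c (us i - us (i + 1)) (vs i)"
        using i by (simp add: us_def vs_def pairing_simps)
    qed auto
    also have "(\<Sum>i=2..n. - c (xs (i - 1) - xs i) (ys i)) = - (\<Sum>i=2..n. c (xs (i - 1) - xs i) (ys i))"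
      by (rule sum_negf)
    finally show "c x b + \<beta> + c (a - x) y \<le> 0"
      using n(4,5) by (simp add: pairing_simps)
  qed
next
  assume J: "\<forall>(x, y)\<in>Graph T. joinable c T x y"
  show "cyclically_monotone c T"
    unfolding cyclically_monotone_def
  proof (intro allI impI, elim conjE)
    fix n :: nat and us vs assume n: "2 \<le> n" and in_T: "\<forall>i\<in>{1..n}. (us i, vs i) \<in> Graph T"
      and cyc: "us (n + 1) = us 1"
    obtain m where m: "n = m + 1" "1 \<le> m" using n by (cases n) auto
    define xs where "xs i = us (m + 2 - i)" for i
    define ys where "ys i = vs (m + 2 - i)" for i
    have "chain_affine c T (xs m) (ys 1)
        ((\<Sum>i=2..m. c (xs (i - 1) - xs i) (ys i)) - c (xs 1) (ys 1))"
    proof (rule chain_affine_of_sequence[OF m(2)], rule ballI)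
      fix i assume "i \<in> {1..m}"
      then have "m + 2 - i \<in> {1..n}" using m by auto
      then show "(xs i, ys i) \<in> Graph T" using in_T by (simp add: xs_def ys_def)
    qed
    moreover have "joinable c T (us 1) (vs 1)" using J in_T n by auto
    ultimately have "c (us 1) (ys 1) + ((\<Sum>i=2..m. c (xs (i - 1) - xs i) (ys i)) - c (xs 1) (ys 1))
        + c (xs m - us 1) (vs 1) \<le> 0" by (auto simp: joinable_def)
    moreover have "(\<Sum>i=2..m. c (xs (i - 1) - xs i) (ys i)) = (\<Sum>i=2..m. - c (us i - us (i + 1)) (vs i))"
    proof (rule sum.reindex_bij_witness[where i = "\<lambda>i. m + 2 - i" and j = "\<lambda>i. m + 2 - i"])
      fix i assume i: "i \<in> {2..m}"
      have "m + 2 - (i - 1) = m + 2 - i + 1" using i by auto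
      then show "- c (us (m + 2 - i) - us (m + 2 - i + 1)) (vs (m + 2 - i))
          = c (xs (i - 1) - xs i) (ys i)"
        using i by (simp add: xs_def ys_def pairing_simps)
    qed auto
    moreover have "(\<Sum>i=1..n. c (us i - us (i + 1)) (vs i))
        = c (us 1 - us 2) (vs 1) + ((\<Sum>i=2..m. c (us i - us (i + 1)) (vs i))
          + c (us n - us 1) (vs n))"
      using m cyc by (subst sum.atLeast_Suc_atMost) (auto simp: numeral_2_eq_2)
    ultimately show "0 \<le> (\<Sum>i=1..n. c (us i - us (i + 1)) (vs i))"
      using m by (simp only: xs_def ys_def sum_negf) (simp add: bilinear_lsub[OF bilinear] numeral_2_eq_2)
  qed
qed

lemma fitzpatrick_inf_eq:
  "fitzpatrick_inf c T x y = Sup {ereal (c x b + \<beta> + c a y) |a b \<beta>. chain_affine c T a b \<beta>}"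
    (is "_ = Sup ?C")
proof (rule antisym)
  show "fitzpatrick_inf c T x y \<le> Sup ?C"
    unfolding fitzpatrick_inf_def
  proof (rule SUP_least)
    fix n :: nat assume "n \<in> {1..}"
    then have n: "1 \<le> n" by simp
    show "fitzpatrick c T n x y \<le> Sup ?C"
      unfolding fitzpatrick_def
    proof (rule Sup_least, clarify)
      fix xs ys assume "\<forall>i\<in>{1..n}. (xs i, ys i) \<in> Graph T"
      from chain_affine_of_sequence[OF n this]
      show "ereal (c (x - xs 1) (ys 1) + (\<Sum>i=2..n. c (xs (i - 1) - xs i) (ys i)) + c (xs n) y)
          \<le> Sup ?C"
        by (intro Sup_upper CollectI exI conjI) (auto simp: pairing_simps)
    qed
  qed
  show "Sup ?C \<le> fitzpatrick_inf c T x y"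
  proof (rule Sup_least, clarify)
    fix a b \<beta> assume "chain_affine c T a b \<beta>"
    from chain_affine_sequence[OF this] obtain n :: nat and xs ys where n: "1 \<le> n"
      "\<forall>i\<in>{1..n}. (xs i, ys i) \<in> Graph T" "xs n = a" "ys 1 = b"
      "(\<Sum>i=2..n. c (xs (i - 1) - xs i) (ys i)) - c (xs 1) (ys 1) = \<beta>" by blast
    have "ereal (c x b + \<beta> + c a y) \<le> fitzpatrick c T n x y"
      unfolding fitzpatrick_def
      by (rule Sup_upper) (use n in \<open>auto simp: pairing_simps intro!: exI[of _ xs] exI[of _ ys]\<close>)
    also have "\<dots> \<le> fitzpatrick_inf c T x y"
      unfolding fitzpatrick_inf_def by (rule SUP_upper) (use n in simp)
    finally show "ereal (c x b + \<beta> + c a y) \<le> fitzpatrick_inf c T x y" .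
  qed
qed

section \<open>Potentials of cyclically monotone relations\<close>

text \<open>
  Subgradient inequalities compose along a chain.
\<close>

lemma chain_affine_le_subgradients:
  assumes "chain_affine c T a b \<beta>" and "Graph T \<subseteq> Graph (subdifferential c g)"
  shows "g a + ereal (c x b + \<beta>) \<le> g x"
  using assms
proof (induction arbitrary: x)
  case (single a b)
  then obtain r where "g a = ereal r" "\<And>w. ereal (r + c (w - a) b) \<le> g w"
    by (metis in_Graph_subdifferential_iff subsetD)
  from this(1) this(2)[of x] show ?case by (simp add: pairing_simps algebra_simps)
next
  case (step p q a b \<beta>)
  then obtain r where r: "g p = ereal r" "\<And>w. ereal (r + c (w - p) q) \<le> g w"
    by (metis in_Graph_subdifferential_iff subsetD)
  from step.IH[OF step.prems, of p] r(1) r(2)[of x] show ?case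
    by (cases "g a"; cases "g x") (auto simp: pairing_simps)
qed

lemma cyclically_monotone_if_subgradients:
  assumes "Graph T \<subseteq> Graph (subdifferential c g)"
  shows "cyclically_monotone c T"
  unfolding cyclically_monotone_iff_joinable joinable_def
proof clarify
  fix x y a b \<beta> assume xy: "(x, y) \<in> Graph T" and ch: "chain_affine c T a b \<beta>"
  from assms xy obtain r where r: "g x = ereal r" "\<And>w. ereal (r + c (w - x) y) \<le> g w"
    by (metis in_Graph_subdifferential_iff subsetD)
  from chain_affine_le_subgradients[OF ch assms, of x] r(1) r(2)[of a]
  show "c x b + \<beta> + c (a - x) y \<le> 0" by (cases "g a") auto
qed

lemma chain_affine_end_in_domain:
  assumes "chain_affine c T a b \<beta>" shows "\<exists>b'. (a, b') \<in> Graph T"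
  using assms by induction auto

text \<open>
  Rockafellar's construction, with \<open>(x, y)\<close> as base point: the supremum of the affine functions of all
  chains that end with the link \<open>(x, y)\<close>. Joinability says that its value at \<open>x\<close> is \<open>0\<close>. Prefixing a
  chain by a link \<open>(p, q)\<close> of \<open>T\<close> is the subgradient inequality at \<open>p\<close>, and applied at \<open>x\<close> it also
  bounds the value at \<open>p\<close>.
\<close>

lemma ex_Gamma_potential:
  assumes J: "joinable c T x y"
  shows "\<exists>g\<in>Gamma_sigma c. insert (x, y) (Graph T) \<subseteq> Graph (subdifferential c g)"
proof -
  define A where "A = insert (y, - c x y) {(b, \<beta> + c (a - x) y) |a b \<beta>. chain_affine c T a b \<beta>}"
  define g where "g w = (SUP (b, \<beta>)\<in>A. ereal (c w b + \<beta>))" for w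
  have ge: "ereal (c w b + \<beta>) \<le> g w" if "(b, \<beta>) \<in> A" for w b \<beta>
    unfolding g_def using that by (intro SUP_upper2[of "(b, \<beta>)"]) auto
  have yA: "(y, - c x y) \<in> A" by (simp add: A_def)
  have "g x \<le> 0" unfolding g_def
    by (rule SUP_least) (use J in \<open>auto simp: A_def joinable_def algebra_simps\<close>)
  moreover have "0 \<le> g x" using ge[OF yA, of x] by (simp add: zero_ereal_def)
  ultimately have gx: "g x = ereal 0" by (simp add: zero_ereal_def)
  have "g \<in> Gamma_sigma c"
    by (rule affine_sup_in_Gamma[of A g x]) (use yA gx in \<open>auto simp: g_def\<close>)
  moreover have "(x, y) \<in> Graph (subdifferential c g)"
    unfolding in_Graph_subdifferential_iff using gx ge[OF yA]
    by (intro exI[of _ 0]) (auto simp: pairing_simps)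
  moreover have "(p, q) \<in> Graph (subdifferential c g)" if pq: "(p, q) \<in> Graph T" for p q
  proof -
    \<comment> \<open>Chains are prefixed by \<open>(p, q)\<close>; the empty one, which gives slope \<open>y\<close>, needs a separate argument.\<close>
    have ext: "(q, c p b + \<beta> - c p q) \<in> A" if mem: "(b, \<beta>) \<in> A" for b \<beta>
    proof (cases "(b, \<beta>) = (y, - c x y)")
      case True
      have "chain_affine c T p q (- c p q)" using pq by (rule chain_affine.single)
      then show ?thesis using True unfolding A_def
        by (intro insertI2 CollectI exI[of _ p] exI[of _ q] exI[of _ "- c p q"])
          (simp add: pairing_simps)
    next
      case False
      then obtain a \<beta>' where "\<beta> = \<beta>' + c (a - x) y" "chain_affine c T a b \<beta>'"
        using mem False unfolding A_def by blast
      with chain_affine.step[OF pq this(2)] show ?thesis unfolding A_def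
        by (intro insertI2 CollectI exI[of _ a] exI[of _ q] exI[of _ "c p b + \<beta>' - c p q"])
          simp
    qed
    have gp: "g p + ereal (c (w - p) q) \<le> g w" for w
    proof -
      have "g p \<le> g w - ereal (c (w - p) q)"
        unfolding g_def[of p]
      proof (rule SUP_least, clarify)
        fix b \<beta> assume "(b, \<beta>) \<in> A"
        from ge[OF ext[OF this], of w] show "ereal (c p b + \<beta>) \<le> g w - ereal (c (w - p) q)"
          by (cases "g w") (auto simp: pairing_simps)
      qed
      then show ?thesis by (cases "g w"; cases "g p") auto
    qed
    have "g p \<noteq> \<infinity>" using gp[of x] gx by auto
    moreover have "g p \<noteq> -\<infinity>" using ge[OF yA, of p] by auto
    ultimately obtain r where "g p = ereal r" by (cases "g p") auto
    then show ?thesis unfolding in_Graph_subdifferential_iff using gp by auto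
  qed
  ultimately show ?thesis by auto
qed

lemma joinable_if_cyclically_monotone:
  assumes "cyclically_monotone c S" and "Graph T \<subseteq> Graph S" and "(x, y) \<in> Graph S"
  shows "joinable c T x y"
  using assms unfolding cyclically_monotone_iff_joinable joinable_def
  by (blast intro: chain_affine_mono)

end

section \<open>Maximal extensions\<close>

context dual_system
begin

text \<open>
  A chain has finitely many links, so all of them lie in one member of a directed family.
\<close>

lemma chain_affine_Union:
  assumes "chain_affine c T a b \<beta>" and "Graph T = \<Union>\<C>"
    and chain: "\<And>G H. G \<in> \<C> \<Longrightarrow> H \<in> \<C> \<Longrightarrow> G \<subseteq> H \<or> H \<subseteq> G"
  shows "\<exists>S. Graph S \<in> \<C> \<and> chain_affine c S a b \<beta>"
proof -
  have op: "Graph (\<lambda>x. {y. (x, y) \<in> G}) = G" for G :: "('a \<times> 'b) set" by (auto simp: Graph_def)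
  from assms(1) show ?thesis
  proof induction
    case (single a b)
    then obtain G where "G \<in> \<C>" "(a, b) \<in> G" using assms(2) by auto
    then show ?case
      using chain_affine.single[of a b "\<lambda>x. {y. (x, y) \<in> G}" c]
      by (intro exI[of _ "\<lambda>x. {y. (x, y) \<in> G}"]) (simp add: op)
  next
    case (step p q a b \<beta>)
    then obtain S where S: "Graph S \<in> \<C>" "chain_affine c S a b \<beta>" by auto
    obtain G where G: "G \<in> \<C>" "(p, q) \<in> G" using step.hyps(1) assms(2) by auto
    from chain[OF S(1) G(1)] show ?case
    proof
      assume "Graph S \<subseteq> G"
      then have "chain_affine c (\<lambda>x. {y. (x, y) \<in> G}) a b \<beta>"
        using chain_affine_mono[OF S(2)] op by metis
      from chain_affine.step[OF _ this, of p q] show ?thesis using G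
        by (intro exI[of _ "\<lambda>x. {y. (x, y) \<in> G}"]) (simp add: op)
    next
      assume "G \<subseteq> Graph S"
      then have "(p, q) \<in> Graph S" using G by blast
      from chain_affine.step[OF this S(2)] show ?thesis using S(1) by blast
    qed
  qed
qed

lemma ex_maximal_extension:
  assumes "cyclically_monotone c T"
  shows "\<exists>S. maximal_cyclically_monotone c S \<and> Graph T \<subseteq> Graph S"
proof -
  have op: "\<exists>S. Graph S = G" for G :: "('a \<times> 'b) set"
    by (intro exI[of _ "\<lambda>x. {y. (x, y) \<in> G}"]) (auto simp: Graph_def)
  define \<A> where "\<A> = {Graph S |S. cyclically_monotone c S \<and> Graph T \<subseteq> Graph S}"
  have "\<exists>M\<in>\<A>. \<forall>X\<in>\<A>. M \<subseteq> X \<longrightarrow> X = M"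
  proof (rule subset_Zorn_nonempty)
    show "\<A> \<noteq> {}" using assms by (auto simp: \<A>_def)
    fix \<C> assume ne: "\<C> \<noteq> {}" and ch: "subset.chain \<A> \<C>"
    then have sub: "\<C> \<subseteq> \<A>" and tot: "\<And>G H. G \<in> \<C> \<Longrightarrow> H \<in> \<C> \<Longrightarrow> G \<subseteq> H \<or> H \<subseteq> G"
      by (auto simp: subset_chain_def)
    obtain U where U: "Graph U = \<Union>\<C>" using op by blast
    have "joinable c U x y" if xy: "(x, y) \<in> Graph U" for x y
      unfolding joinable_def
    proof (intro allI impI)
      fix a b \<beta> assume "chain_affine c U a b \<beta>"
      from chain_affine_Union[OF this U tot] obtain S where
        S: "Graph S \<in> \<C>" "chain_affine c S a b \<beta>" by blast
      obtain G where G: "G \<in> \<C>" "(x, y) \<in> G" using xy U by auto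
      obtain R where R: "Graph R \<in> \<C>" "Graph S \<subseteq> Graph R" "G \<subseteq> Graph R"
      proof (cases "G \<subseteq> Graph S")
        case True
        then show ?thesis using that[of S] S(1) by simp
      next
        case False
        then have "Graph S \<subseteq> G" using tot[OF S(1) G(1)] by blast
        moreover obtain R where "Graph R = G" using op by blast
        ultimately show ?thesis using that[of R] G(1) by simp
      qed
      obtain R' where "Graph R = Graph R'" "cyclically_monotone c R'"
        using R(1) sub unfolding \<A>_def by blast
      then have "cyclically_monotone c R" using Graph_inject[of R R'] by simp
      then have "joinable c R x y"
        using R G by (auto simp: cyclically_monotone_iff_joinable)
      then show "c x b + \<beta> + c (a - x) y \<le> 0"
        using chain_affine_mono[OF S(2) R(2)] by (auto simp: joinable_def)
    qed
    then have "cyclically_monotone c U" by (auto simp: cyclically_monotone_iff_joinable)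
    moreover have "Graph T \<subseteq> Graph U"
    proof -
      obtain G where "G \<in> \<C>" using ne by blast
      then have "Graph T \<subseteq> G" using sub unfolding \<A>_def by blast
      then show ?thesis using U \<open>G \<in> \<C>\<close> by blast
    qed
    ultimately show "\<Union>\<C> \<in> \<A>" unfolding \<A>_def U[symmetric] by blast
  qed
  then obtain M where M: "M \<in> \<A>" "\<And>X. X \<in> \<A> \<Longrightarrow> M \<subseteq> X \<Longrightarrow> X = M" by blast
  then obtain S where S: "M = Graph S" "cyclically_monotone c S" "Graph T \<subseteq> Graph S"
    unfolding \<A>_def by blast
  have "\<not> Graph S \<subset> Graph R" if "cyclically_monotone c R" for R
  proof
    assume less: "Graph S \<subset> Graph R"
    then have "Graph R \<in> \<A>" using S that unfolding \<A>_def by blast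
    with M(2)[OF this] less S(1) show False by blast
  qed
  then show ?thesis using S(2,3) by (auto simp: maximal_cyclically_monotone_def)
qed

section \<open>Chains that nearly close\<close>

text \<open>
  Restates the inequality between the Fitzpatrick function of infinite order and the pairing,
  without suprema in the extended reals.
\<close>

definition chains_nearly_close :: "('a \<Rightarrow> 'b set) \<Rightarrow> bool" where
  "chains_nearly_close T \<longleftrightarrow> (\<forall>x y e. 0 < e \<longrightarrow>
     (\<exists>a b \<beta>. chain_affine c T a b \<beta> \<and> - e < c x b + \<beta> + c (a - x) y))"

lemma chains_nearly_closeD:
  assumes "chains_nearly_close T" "0 < e"
  obtains a b \<beta> where "chain_affine c T a b \<beta>" "- e < c x b + \<beta> + c (a - x) y"
  using assms unfolding chains_nearly_close_def by blast

lemma fitzpatrick_inf_ge_iff: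
  "(\<forall>x y. fitzpatrick_inf c T x y \<ge> ereal (c x y)) \<longleftrightarrow> chains_nearly_close T"
proof
  assume F: "\<forall>x y. fitzpatrick_inf c T x y \<ge> ereal (c x y)"
  show "chains_nearly_close T" unfolding chains_nearly_close_def
  proof (intro allI impI)
    fix x y and e :: real assume "0 < e"
    then have "ereal (c x y - e) < ereal (c x y)" by simp
    also have "\<dots> \<le> fitzpatrick_inf c T x y" using F by blast
    finally show "\<exists>a b \<beta>. chain_affine c T a b \<beta> \<and> - e < c x b + \<beta> + c (a - x) y"
      unfolding fitzpatrick_inf_eq less_Sup_iff by (fastforce simp: pairing_simps)
  qed
next
  assume D: "chains_nearly_close T"
  show "\<forall>x y. fitzpatrick_inf c T x y \<ge> ereal (c x y)"
  proof (intro allI)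
    fix x y
    show "fitzpatrick_inf c T x y \<ge> ereal (c x y)"
    proof (rule ereal_le_epsilon2)
      fix e :: real assume "0 < e"
      from chains_nearly_closeD[OF D this, of x y] obtain a b \<beta> where
        ch: "chain_affine c T a b \<beta>" "- e < c x b + \<beta> + c (a - x) y" .
      then have "ereal (c x y) \<le> ereal (c x b + \<beta> + c a y) + ereal e"
        by (simp add: pairing_simps)
      also have "\<dots> \<le> fitzpatrick_inf c T x y + ereal e"
        unfolding fitzpatrick_inf_eq using ch by (intro add_right_mono Sup_upper) blast
      finally show "ereal (c x y) \<le> fitzpatrick_inf c T x y + ereal e" .
    qed
  qed
qed

text \<open>
  The chain supplied by the averaged slope is nearly exact for the sum of the two potentials. As it
  is a minorant of each one separately, it loses little for either.
\<close>

lemma common_approximate_subgradient: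
  assumes D: "chains_nearly_close T"
    and h: "h \<in> Gamma_sigma c" "Graph T \<subseteq> Graph (subdifferential c h)" "h x = ereal H"
    and k: "k \<in> Gamma_sigma c" "Graph T \<subseteq> Graph (subdifferential c k)" "k x = ereal K"
    and e: "0 < e"
  shows "\<exists>b. \<forall>w. ereal (H + c (w - x) b - e) \<le> h w \<and> ereal (K + c (w - x) b - e) \<le> k w"
proof -
  define d where "d = e / 4"
  have d: "0 < d" using e by (simp add: d_def)
  obtain a0 b0 \<beta>0 where "chain_affine c T a0 b0 \<beta>0" using chains_nearly_closeD[OF D d] by blast
  then obtain b0' where "(a0, b0') \<in> Graph T" using chain_affine_end_in_domain by blast
  then have sub: "(a0, b0') \<in> Graph (subdifferential c h)" "(a0, b0') \<in> Graph (subdifferential c k)"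
    using h k by auto
  obtain y1 where y1: "\<And>w. ereal (H - d + c (w - x) y1) \<le> h w"
    using affine_minorant_below[OF h(1) sub(1), of "H - d" x] h(3) d by auto
  obtain y2 where y2: "\<And>w. ereal (K - d + c (w - x) y2) \<le> k w"
    using affine_minorant_below[OF k(1) sub(2), of "K - d" x] k(3) d by auto
  \<comment> \<open>Minorants of slopes \<open>y1\<close> and \<open>y2\<close> enter only through their sum, hence the averaged slope.\<close>
  obtain a b \<beta> where ch: "chain_affine c T a b \<beta>"
    and lt: "- d < c x b + \<beta> + c (a - x) ((1/2) *\<^sub>R (y1 + y2))"
    using chains_nearly_closeD[OF D d] by blast
  have lt': "- 2 * d < 2 * (c x b + \<beta>) + c (a - x) y1 + c (a - x) y2"
  proof -
    have "c (a - x) ((1/2) *\<^sub>R (y1 + y2)) = (c (a - x) y1 + c (a - x) y2) / 2"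
      unfolding bilinear_rmul[OF bilinear] bilinear_radd[OF bilinear] by simp
    then have "- d < c x b + \<beta> + (c (a - x) y1 + c (a - x) y2) / 2" using lt by (simp only:)
    then show ?thesis by (simp add: field_simps)
  qed
  obtain b' where "(a, b') \<in> Graph T" using chain_affine_end_in_domain[OF ch] by blast
  then obtain Ha Ka where Ha: "h a = ereal Ha" and Ka: "k a = ereal Ka"
    using h(2) k(2) by (meson in_Graph_subdifferential_iff subsetD)
  have hw: "ereal (Ha + c w b + \<beta>) \<le> h w" and kw: "ereal (Ka + c w b + \<beta>) \<le> k w" for w
    using chain_affine_le_subgradients[OF ch h(2), of w] chain_affine_le_subgradients[OF ch k(2), of w]
      Ha Ka by (simp_all add: add.assoc)
  have 1: "H - d + c (a - x) y1 \<le> Ha" "K - d + c (a - x) y2 \<le> Ka"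
    using y1[of a] y2[of a] Ha Ka by simp_all
  have 2: "Ha + c x b + \<beta> \<le> H" "Ka + c x b + \<beta> \<le> K"
    using hw[of x] kw[of x] h(3) k(3) by simp_all
  have 3: "H - e \<le> Ha + c x b + \<beta>" "K - e \<le> Ka + c x b + \<beta>"
    using 1 2 lt' by (auto simp: d_def)
  show ?thesis
  proof (intro exI[of _ b] allI conjI)
    fix w
    have "ereal (H + c (w - x) b - e) \<le> ereal (Ha + c w b + \<beta>)"
      using 3 by (simp add: bilinear_lsub[OF bilinear])
    then show "ereal (H + c (w - x) b - e) \<le> h w" using hw[of w] by (rule order_trans)
    have "ereal (K + c (w - x) b - e) \<le> ereal (Ka + c w b + \<beta>)"
      using 3 by (simp add: bilinear_lsub[OF bilinear])
    then show "ereal (K + c (w - x) b - e) \<le> k w" using kw[of w] by (rule order_trans)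
  qed
qed

text \<open>
  Since the roles of \<open>h\<close> and \<open>k\<close> and those of \<open>p\<close> and \<open>q\<close> can be exchanged, this says that two
  potentials of \<open>T\<close> differ by a constant on the domain of \<open>T\<close>.
\<close>

lemma potential_increments_le:
  assumes D: "chains_nearly_close T"
    and h: "h \<in> Gamma_sigma c" "Graph T \<subseteq> Graph (subdifferential c h)"
    and k: "k \<in> Gamma_sigma c" "Graph T \<subseteq> Graph (subdifferential c k)"
    and p: "(p, bp) \<in> Graph T" and q: "(q, bq) \<in> Graph T"
  shows "real_of_ereal (k q) - real_of_ereal (k p) \<le> real_of_ereal (h q) - real_of_ereal (h p)"
proof -
  define z where "z t = (1 - t) *\<^sub>R p + t *\<^sub>R q" for t :: real
  have finite_on_segment: "g (z t) = ereal (real_of_ereal (g (z t)))"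
    if g: "g \<in> Gamma_sigma c" "Graph T \<subseteq> Graph (subdifferential c g)" and t: "t \<in> {0..1}" for g t
  proof -
    have "g p \<noteq> \<infinity>" "g q \<noteq> \<infinity>"
      using subsetD[OF g(2) p] subsetD[OF g(2) q] by (auto simp: in_Graph_subdifferential_iff)
    moreover have "convex {w. g w \<noteq> \<infinity>}"
      using Gamma_domain_convex[OF g(1)] by (rule convex_on_imp_convex)
    ultimately have "g (z t) \<noteq> \<infinity>" using t unfolding z_def by (auto simp: convex_alt)
    moreover have "g (z t) \<noteq> -\<infinity>" using g(1) by (auto simp: Gamma_sigma_def proper_fun_def)
    ultimately show ?thesis by (cases "g (z t)") auto
  qed
  define f where "f t = real_of_ereal (h (z t))" for t
  define g where "g t = real_of_ereal (k (z t))" for t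
  have f: "h (z t) = ereal (f t)" and g: "k (z t) = ereal (g t)" if "t \<in> {0..1}" for t
    using finite_on_segment[OF h that] finite_on_segment[OF k that] by (auto simp: f_def g_def)
  have zdiff: "c (z s - z t) b = c (q - p) b * (s - t)" for s t b
    by (simp add: z_def pairing_simps algebra_simps)
  have z01: "z 0 = p" "z 1 = q" by (simp_all add: z_def)
  have sub: "f t + c (q - p) b * (s - t) \<le> f s \<and> g t + c (q - p) b * (s - t) \<le> g s"
    if "(z t, b) \<in> Graph T" "t \<in> {0..1}" "s \<in> {0..1}" for s t b
  proof -
    have "(z t, b) \<in> Graph (subdifferential c h)" "(z t, b) \<in> Graph (subdifferential c k)"
      using that h k by auto
    then have "ereal (f t + c (z s - z t) b) \<le> h (z s)" "ereal (g t + c (z s - z t) b) \<le> k (z s)"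
      unfolding in_Graph_subdifferential_iff using f[OF that(2)] g[OF that(2)] by auto
    then show ?thesis using f[OF that(3)] g[OF that(3)] by (simp add: zdiff)
  qed
  have "g 1 - g 0 \<le> f 1 - f 0"
  proof (rule increment_le_if_common_subgradients)
    fix t e :: real assume t: "t \<in> {0..1}" and e: "0 < e"
    obtain b where b: "\<And>w. ereal (f t + c (w - z t) b - e) \<le> h w"
      "\<And>w. ereal (g t + c (w - z t) b - e) \<le> k w"
      using common_approximate_subgradient[OF D h f[OF t] k g[OF t] e] by auto
    show "\<exists>b. \<forall>s\<in>{0..1}. f t + b * (s - t) - e \<le> f s \<and> g t + b * (s - t) - e \<le> g s"
    proof (intro exI[of _ "c (q - p) b"] ballI)
      fix s :: real assume "s \<in> {0..1}"
      then show "f t + c (q - p) b * (s - t) - e \<le> f s \<and> g t + c (q - p) b * (s - t) - e \<le> g s"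
        using b(1)[of "z s"] b(2)[of "z s"] f[of s] g[of s] by (simp add: zdiff)
    qed
  next
    fix s :: real assume "s \<in> {0..1}"
    then show "f 0 + c (q - p) bp * s \<le> f s \<and> g 0 + c (q - p) bp * s \<le> g s"
      using sub[of 0 bp s] p z01 by simp
    show "f 1 + c (q - p) bq * (s - 1) \<le> f s \<and> g 1 + c (q - p) bq * (s - 1) \<le> g s"
      using sub[of 1 bq s] q z01 \<open>s \<in> {0..1}\<close> by simp
  qed
  then show ?thesis by (simp add: f_def g_def z01)
qed

text \<open>
  For a point \<open>(x, y)\<close> of an extension, let \<open>k\<close> be a potential of \<open>T\<close> and \<open>(x, y)\<close>, and \<open>s\<close> the constant
  value of \<open>h - k\<close> on the domain of \<open>T\<close>. Chains that nearly close carry inequalities known at points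
  of that domain over to arbitrary points. With slope \<open>y\<close> the subgradient of \<open>k\<close> at \<open>x\<close> turns into
  \<open>k x + s + c (w - x) y \<le> h w\<close>; with the slope of an affine minorant of \<open>h\<close> one obtains \<open>h x \<le> k x + s\<close>.
  Together these say that \<open>y\<close> is a subgradient of \<open>h\<close> at \<open>x\<close>.
\<close>

lemma maximal_if_chains_nearly_close:
  assumes h: "h \<in> Gamma_sigma c" and T: "T = subdifferential c h" and D: "chains_nearly_close T"
  shows "maximal_cyclically_monotone c T"
proof -
  have Th: "Graph T \<subseteq> Graph (subdifferential c h)" using T by simp
  have "(x, y) \<in> Graph T" if S: "cyclically_monotone c S" "Graph T \<subseteq> Graph S" "(x, y) \<in> Graph S"
    for S x y
  proof -
    obtain k where k: "k \<in> Gamma_sigma c" "(x, y) \<in> Graph (subdifferential c k)"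
        "Graph T \<subseteq> Graph (subdifferential c k)"
      using ex_Gamma_potential[OF joinable_if_cyclically_monotone[OF S]] by auto
    obtain K where K: "k x = ereal K" "\<And>w. ereal (K + c (w - x) y) \<le> k w"
      using k(2) by (auto simp: in_Graph_subdifferential_iff)
    obtain a0 b0 \<beta>0 where "chain_affine c T a0 b0 \<beta>0" using chains_nearly_closeD[OF D zero_less_one] by blast
    then obtain b0' where a0: "(a0, b0') \<in> Graph T" using chain_affine_end_in_domain by blast
    define s where "s = real_of_ereal (h a0) - real_of_ereal (k a0)"
    have shift: "h a = k a + ereal s" if ab: "(a, b) \<in> Graph T" for a b
    proof -
      have "real_of_ereal (h a) = real_of_ereal (k a) + s"
        using potential_increments_le[OF D h Th k(1,3) a0 ab]
          potential_increments_le[OF D h Th k(1,3) ab a0] by (simp add: s_def)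
      moreover obtain Ha Ka where "h a = ereal Ha" "k a = ereal Ka"
        using Th k(3) ab by (meson in_Graph_subdifferential_iff subsetD)
      ultimately show ?thesis by simp
    qed
    have chain_shift: "\<exists>a Ka. h a = ereal (Ka + s) \<and> k a = ereal Ka \<and>
        ereal (Ka + s - c (a - w) y' - e) \<le> h w \<and>
        ereal (Ka - c (a - w) y' - e) \<le> k w" if e: "0 < e" for w y' e
    proof -
      obtain a b \<beta> where ch: "chain_affine c T a b \<beta>" and lt: "- e < c w b + \<beta> + c (a - w) y'"
        using chains_nearly_closeD[OF D e] by blast
      obtain b' where b': "(a, b') \<in> Graph T" using chain_affine_end_in_domain[OF ch] by blast
      then obtain Ka where Ka: "k a = ereal Ka"
        using k(3) by (meson in_Graph_subdifferential_iff subsetD)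
      have Ha: "h a = ereal (Ka + s)" using shift[OF b'] Ka by simp
      have "ereal (Ka + s - c (a - w) y' - e) \<le> h a + ereal (c w b + \<beta>)"
        "ereal (Ka - c (a - w) y' - e) \<le> k a + ereal (c w b + \<beta>)" using Ha Ka lt by simp_all
      from order_trans[OF this(1) chain_affine_le_subgradients[OF ch Th]]
        order_trans[OF this(2) chain_affine_le_subgradients[OF ch k(3)]]
      show ?thesis using Ha Ka by blast
    qed
    have h_above: "ereal (K + s + c (w - x) y) \<le> h w" for w
    proof (rule ereal_le_epsilon2)
      fix e :: real assume "0 < e"
      from chain_shift[OF this, of w y] obtain a Ka where a: "k a = ereal Ka"
        "ereal (Ka + s - c (a - w) y - e) \<le> h w" by blast
      have "K + c (a - x) y \<le> Ka" using K(2)[of a] a(1) by simp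
      then have "ereal (K + s + c (w - x) y - e) \<le> h w"
        using a(2) by (cases "h w") (auto simp: bilinear_lsub[OF bilinear])
      then show "ereal (K + s + c (w - x) y) \<le> h w + ereal e" by (cases "h w") auto
    qed
    have "h x \<le> ereal (K + s)"
    proof (rule ccontr)
      assume "\<not> ?thesis"
      then obtain r where r: "K + s < r" "ereal r < h x"
        using ereal_dense2[of "ereal (K + s)" "h x"] by (auto simp: not_le)
      obtain y' where y': "\<And>w. ereal (r + c (w - x) y') \<le> h w"
        using affine_minorant_below[OF h _ r(2)] a0 Th by blast
      from chain_shift[of "(r - (K + s)) / 2" x y'] r obtain a Ka where
        a: "h a = ereal (Ka + s)" "ereal (Ka - c (a - x) y' - (r - (K + s)) / 2) \<le> k x" by auto
      show False using y'[of a] a K(1) r(1) by (simp add: field_simps)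
    qed
    moreover have "ereal (K + s) \<le> h x" using h_above[of x] by (simp add: bilinear_lzero[OF bilinear])
    ultimately have "h x = ereal (K + s)" by (rule antisym)
    then have "(x, y) \<in> Graph (subdifferential c h)"
      using h_above by (auto simp: in_Graph_subdifferential_iff)
    then show ?thesis using T by simp
  qed
  moreover have "cyclically_monotone c T" using Th by (rule cyclically_monotone_if_subgradients)
  ultimately show ?thesis unfolding maximal_cyclically_monotone_def by (auto simp: subset_eq)
qed

text \<open>
  A margin \<open>d\<close> between the closed chains at \<open>(x, y)\<close> and \<open>0\<close> leaves room to move either \<open>x\<close> towards
  \<open>a0\<close> or \<open>y\<close> towards \<open>b0\<close>, where \<open>(a0, b0)\<close> is a point of the graph. Both points then lie in the
  unique maximal extension, although they violate monotonicity by a multiple of the pairing of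
  \<open>x - a0\<close> with \<open>y - b0\<close>. If the graph is empty, every point belongs to the unique extension, so the
  pairing vanishes, \<open>h\<close> is constant and its subdifferential is everything, a contradiction.
\<close>

lemma chains_nearly_close_if_unique_extension:
  assumes h: "h \<in> Gamma_sigma c" and T: "T = subdifferential c h"
    and uniq: "\<And>S S'. maximal_cyclically_monotone c S \<Longrightarrow> maximal_cyclically_monotone c S' \<Longrightarrow>
      Graph T \<subseteq> Graph S \<Longrightarrow> Graph T \<subseteq> Graph S' \<Longrightarrow> S = S'"
  shows "chains_nearly_close T"
proof (rule ccontr)
  have mono: "0 \<le> c (x - x') (y - y')" if J: "joinable c T x y" and J': "joinable c T x' y'" for x y x' y'
  proof -
    have ext: "\<exists>S. maximal_cyclically_monotone c S \<and> Graph T \<subseteq> Graph S \<and> (u, v) \<in> Graph S"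
      if uv: "joinable c T u v" for u v
    proof -
      obtain g where "insert (u, v) (Graph T) \<subseteq> Graph (subdifferential c g)"
        using ex_Gamma_potential[OF uv] by blast
      moreover from this obtain S where "maximal_cyclically_monotone c S"
          "Graph (subdifferential c g) \<subseteq> Graph S"
        using ex_maximal_extension[OF cyclically_monotone_if_subgradients[OF order_refl]] by blast
      ultimately show ?thesis by blast
    qed
    obtain S where S: "maximal_cyclically_monotone c S" "(x, y) \<in> Graph S" "(x', y') \<in> Graph S"
      using ext[OF J] ext[OF J'] uniq by blast
    then have "joinable c S x y" by (auto simp: maximal_cyclically_monotone_def cyclically_monotone_iff_joinable)
    moreover have "chain_affine c S x' y' (- c x' y')" using S by (intro chain_affine.single)
    ultimately have "c x y' + - c x' y' + c (x' - x) y \<le> 0" unfolding joinable_def by blast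
    then show ?thesis by (simp add: pairing_simps)
  qed
  assume "\<not> chains_nearly_close T"
  then obtain x y d where d: "0 < d"
    and gap: "\<And>a b \<beta>. chain_affine c T a b \<beta> \<Longrightarrow> c x b + \<beta> + c (a - x) y \<le> - d"
    unfolding chains_nearly_close_def by (meson not_less)
  show False
  proof (cases "Graph T = {}")
    case True
    then have J: "joinable c T u v" for u v
      using chain_affine_end_in_domain unfolding joinable_def by blast
    have c0: "c u v = 0" for u v
      using mono[OF J J, of u 0 v 0] mono[OF J J, of u 0 "- v" 0] by (simp add: pairing_simps)
    have const: "h u \<le> h w" for u w
    proof (rule ccontr)
      assume "\<not> ?thesis"
      then obtain r where "ereal r < h u" "h w < ereal r"
        using ereal_dense2[of "h w" "h u"] by (auto simp: not_le)
      with lsc_nbhd[OF h this(1)] c0 show False by (metis less_asym)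
    qed
    obtain u where "h u \<noteq> \<infinity>" "h u \<noteq> -\<infinity>"
      using h by (auto simp: Gamma_sigma_def proper_fun_def)
    then obtain r where "h u = ereal r" by (cases "h u") auto
    then have "(u, 0) \<in> Graph T"
      unfolding T in_Graph_subdifferential_iff using const[of u] c0 by auto
    then show False using True by simp
  next
    case False
    then obtain a0 b0 where a0: "(a0, b0) \<in> Graph T" by auto
    have "joinable c T x y" using gap d unfolding joinable_def by force
    then obtain g where g: "(x, y) \<in> Graph (subdifferential c g)" "Graph T \<subseteq> Graph (subdifferential c g)"
      using ex_Gamma_potential by blast
    obtain G where G: "g x = ereal G" "\<And>w. ereal (G + c (w - x) y) \<le> g w"
      using g(1) by (auto simp: in_Graph_subdifferential_iff)
    obtain G0 where G0: "g a0 = ereal G0" "\<And>w. ereal (G0 + c (w - a0) b0) \<le> g w"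
      using g(2) a0 by (meson in_Graph_subdifferential_iff subsetD)
    \<comment> \<open>Bounds the closed chain values at the far ends \<open>(x, b0)\<close> and \<open>(a0, y)\<close> of the two moves; they
    vary affinely along each move, so a step of size \<open>d / (d + C)\<close> keeps them nonpositive.\<close>
    define C where "C = max \<bar>G - G0 + c (a0 - x) b0\<bar> \<bar>G0 - G + c (x - a0) y\<bar>"
    define t where "t = d / (d + C)"
    have C: "0 \<le> C" by (simp add: C_def)
    have t: "0 < t" "t \<le> 1" using d C by (auto simp: t_def)
    have tC: "(1 - t) * (- d) + t * C = 0" using d C by (simp add: t_def field_simps)
    have bound: "c x b + \<beta> + c (a - x) b0 \<le> C \<and> c a0 b + \<beta> + c (a - a0) y \<le> C"
      if ch: "chain_affine c T a b \<beta>" for a b \<beta>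
    proof -
      obtain b' where "(a, b') \<in> Graph T" using chain_affine_end_in_domain[OF ch] by blast
      then obtain Ga where Ga: "g a = ereal Ga"
        using g(2) by (meson in_Graph_subdifferential_iff subsetD)
      have "G + c (a - x) y \<le> Ga" "G0 + c (a - a0) b0 \<le> Ga" using G(2)[of a] G0(2)[of a] Ga by auto
      moreover have "Ga + c x b + \<beta> \<le> G" "Ga + c a0 b + \<beta> \<le> G0"
        using chain_affine_le_subgradients[OF ch g(2), of x]
          chain_affine_le_subgradients[OF ch g(2), of a0] Ga G(1) G0(1) by auto
      ultimately show ?thesis unfolding C_def by (auto simp: bilinear_lsub[OF bilinear])
    qed
    have J1: "joinable c T x (y + t *\<^sub>R (b0 - y))"
      unfolding joinable_def
    proof (intro allI impI)
      fix a b \<beta> assume ch: "chain_affine c T a b \<beta>"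
      have "c x b + \<beta> + c (a - x) (y + t *\<^sub>R (b0 - y))
          = (1 - t) * (c x b + \<beta> + c (a - x) y) + t * (c x b + \<beta> + c (a - x) b0)"
        unfolding bilinear_radd[OF bilinear] bilinear_rmul[OF bilinear] bilinear_rsub[OF bilinear]
        by (simp add: algebra_simps)
      also have "\<dots> \<le> (1 - t) * (- d) + t * C"
        using gap[OF ch] bound[OF ch] t by (intro add_mono mult_left_mono) auto
      finally show "c x b + \<beta> + c (a - x) (y + t *\<^sub>R (b0 - y)) \<le> 0" unfolding tC .
    qed
    have J2: "joinable c T (x + t *\<^sub>R (a0 - x)) y"
      unfolding joinable_def
    proof (intro allI impI)
      fix a b \<beta> assume ch: "chain_affine c T a b \<beta>"
      have "c (x + t *\<^sub>R (a0 - x)) b + \<beta> + c (a - (x + t *\<^sub>R (a0 - x))) y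
          = (1 - t) * (c x b + \<beta> + c (a - x) y) + t * (c a0 b + \<beta> + c (a - a0) y)"
        unfolding bilinear_ladd[OF bilinear] bilinear_lmul[OF bilinear] bilinear_lsub[OF bilinear]
        by (simp add: algebra_simps)
      also have "\<dots> \<le> (1 - t) * (- d) + t * C"
        using gap[OF ch] bound[OF ch] t by (intro add_mono mult_left_mono) auto
      finally show "c (x + t *\<^sub>R (a0 - x)) b + \<beta> + c (a - (x + t *\<^sub>R (a0 - x))) y \<le> 0" unfolding tC .
    qed
    have "c (x - a0) (y - b0) \<ge> d"
      using gap[OF chain_affine.single[OF a0]] by (simp add: pairing_simps)
    moreover have "0 \<le> - (t * t) * c (x - a0) (y - b0)"
    proof -
      have "x - (x + t *\<^sub>R (a0 - x)) = t *\<^sub>R (x - a0)"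
        "y + t *\<^sub>R (b0 - y) - y = (- t) *\<^sub>R (y - b0)" by (simp_all add: algebra_simps)
      then show ?thesis
        using mono[OF J1 J2] by (simp only: bilinear_lmul[OF bilinear] bilinear_rmul[OF bilinear]) simp
    qed
    moreover have "0 < t * t" using t by simp
    ultimately show False using d
      by (metis (no_types) less_le_trans minus_mult_left mult_pos_pos neg_0_le_iff_le not_le)
  qed
qed

section \<open>Characterisations of maximality\<close>

text \<open>
  The subdifferential of a potential of \<open>T\<close> and \<open>(x, y)\<close> is a cyclically monotone extension of \<open>T\<close>,
  hence equal to \<open>T\<close>.
\<close>

lemma maximal_joinable:
  assumes T: "maximal_cyclically_monotone c T" and J: "joinable c T x y"
  shows "(x, y) \<in> Graph T" and "\<exists>h\<in>Gamma_sigma c. T = subdifferential c h"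
proof -
  obtain h where h: "h \<in> Gamma_sigma c" "insert (x, y) (Graph T) \<subseteq> Graph (subdifferential c h)"
    using ex_Gamma_potential[OF J] by blast
  have "\<not> Graph T \<subset> Graph (subdifferential c h)"
    using T cyclically_monotone_if_subgradients[OF order_refl]
    unfolding maximal_cyclically_monotone_def by blast
  then have eq: "Graph T = Graph (subdifferential c h)" using h(2) by blast
  then show "(x, y) \<in> Graph T" using h(2) by blast
  show "\<exists>h\<in>Gamma_sigma c. T = subdifferential c h" using h(1) Graph_inject[OF eq] by blast
qed

lemma maximal_is_subdifferential:
  assumes T: "maximal_cyclically_monotone c T"
  shows "\<exists>h\<in>Gamma_sigma c. T = subdifferential c h"
proof -
  have "\<exists>x y. joinable c T x y"
  proof (cases "Graph T = {}")
    case True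
    then show ?thesis using chain_affine_end_in_domain unfolding joinable_def by blast
  next
    case False
    then show ?thesis
      using T unfolding maximal_cyclically_monotone_def cyclically_monotone_iff_joinable by fastforce
  qed
  then show ?thesis using maximal_joinable(2)[OF T] by blast
qed

lemma nonneg_chain_if_maximal:
  assumes T: "maximal_cyclically_monotone c T"
  shows "\<exists>a b \<beta>. chain_affine c T a b \<beta> \<and> 0 \<le> c x b + \<beta> + c (a - x) y"
proof (cases "(x, y) \<in> Graph T")
  case True
  from chain_affine.single[OF this] show ?thesis
    by (intro exI conjI) (auto simp: pairing_simps)
next
  case False
  then show ?thesis using maximal_joinable(1)[OF T, of x y] unfolding joinable_def
    by (meson linear)
qed

end

theorem theorem28:
  fixes c :: "'a::real_vector \<Rightarrow> 'b::real_vector \<Rightarrow> real"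
    and T :: "'a \<Rightarrow> 'b set"
  assumes "bilinear c"
    and "cyclically_monotone c T"
  defines "cond_i \<equiv> maximal_cyclically_monotone c T"
    and "cond_ii \<equiv>
      (\<exists>h\<in>Gamma_sigma c. T = subdifferential c h) \<and>
      (\<forall>x y. \<exists>n\<ge>2. \<exists>(xs :: nat \<Rightarrow> 'a) (ys :: nat \<Rightarrow> 'b).
         (\<forall>i\<in>{1..n-1}. (xs i, ys i) \<in> Graph T) \<and>
         c (x - xs 1) (ys 1) + (\<Sum>i=2..n-1. c (xs (i - 1) - xs i) (ys i))
           + c (xs (n - 1) - x) y \<ge> 0)"
    and "cond_iii \<equiv>
      (\<exists>h\<in>Gamma_sigma c. T = subdifferential c h) \<and>
      (\<forall>x y. fitzpatrick_inf c T x y \<ge> ereal (c x y))"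
    and "cond_iv \<equiv>
      (\<exists>h\<in>Gamma_sigma c. T = subdifferential c h) \<and>
      (\<exists>!S. maximal_cyclically_monotone c S \<and> Graph T \<subseteq> Graph S)"
  shows "(cond_i \<longleftrightarrow> cond_ii) \<and> (cond_i \<longleftrightarrow> cond_iii) \<and> (cond_i \<longleftrightarrow> cond_iv)"
proof -
  interpret dual_system c by unfold_locales (rule assms(1))
  have iii_i: "cond_i" if "cond_iii"
    using that maximal_if_chains_nearly_close
    unfolding cond_iii_def cond_i_def fitzpatrick_inf_ge_iff by blast
  have i_ii: "cond_ii" if "cond_i"
    unfolding cond_ii_def
  proof (intro conjI allI)
    have T: "maximal_cyclically_monotone c T" using that unfolding cond_i_def .
    then show "\<exists>h\<in>Gamma_sigma c. T = subdifferential c h" by (rule maximal_is_subdifferential)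
    fix x y
    from nonneg_chain_if_maximal[OF T, of x y] obtain a b \<beta> where
      ch: "chain_affine c T a b \<beta>" "0 \<le> c x b + \<beta> + c (a - x) y" by blast
    from chain_affine_sequence[OF ch(1)] obtain n :: nat and xs ys where n: "1 \<le> n"
      "\<forall>i\<in>{1..n}. (xs i, ys i) \<in> Graph T" "xs n = a" "ys 1 = b"
      "(\<Sum>i=2..n. c (xs (i - 1) - xs i) (ys i)) - c (xs 1) (ys 1) = \<beta>" by blast
    have "0 \<le> c (x - xs 1) (ys 1) + (\<Sum>i=2..n. c (xs (i - 1) - xs i) (ys i)) + c (xs n - x) y"
      using ch(2) n(3-5) by (simp only: bilinear_lsub[OF bilinear, of x])
    then show "\<exists>n\<ge>2. \<exists>(xs :: nat \<Rightarrow> 'a) (ys :: nat \<Rightarrow> 'b).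
         (\<forall>i\<in>{1..n-1}. (xs i, ys i) \<in> Graph T) \<and>
         c (x - xs 1) (ys 1) + (\<Sum>i=2..n-1. c (xs (i - 1) - xs i) (ys i))
           + c (xs (n - 1) - x) y \<ge> 0"
      using n(1,2) by (intro exI[of _ "n + 1"] conjI exI[of _ xs] exI[of _ ys]) auto
  qed
  have ii_iii: "cond_iii" if ii: "cond_ii"
    unfolding cond_iii_def fitzpatrick_inf_ge_iff chains_nearly_close_def
  proof (intro conjI allI impI)
    show "\<exists>h\<in>Gamma_sigma c. T = subdifferential c h" using ii unfolding cond_ii_def by (rule conjunct1)
    fix x y and e :: real assume "0 < e"
    obtain n :: nat and xs ys where n: "2 \<le> n" "\<forall>i\<in>{1..n-1}. (xs i, ys i) \<in> Graph T"
      and nonneg: "0 \<le> c (x - xs 1) (ys 1) + (\<Sum>i=2..n-1. c (xs (i - 1) - xs i) (ys i))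
           + c (xs (n - 1) - x) y"
      using ii unfolding cond_ii_def by blast
    have "1 \<le> n - 1" using n(1) by simp
    from chain_affine_of_sequence[OF this n(2)]
    show "\<exists>a b \<beta>. chain_affine c T a b \<beta> \<and> - e < c x b + \<beta> + c (a - x) y"
    proof (intro exI conjI)
      show "- e < c x (ys 1) + ((\<Sum>i=2..n-1. c (xs (i - 1) - xs i) (ys i)) - c (xs 1) (ys 1))
          + c (xs (n - 1) - x) y"
        using nonneg \<open>0 < e\<close> unfolding bilinear_lsub[OF bilinear, of x] by linarith
    qed
  qed
  have i_iv: "cond_iv" if "cond_i"
    unfolding cond_iv_def
  proof (intro conjI)
    have T: "maximal_cyclically_monotone c T" using that unfolding cond_i_def .
    then show "\<exists>h\<in>Gamma_sigma c. T = subdifferential c h" by (rule maximal_is_subdifferential)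
    show "\<exists>!S. maximal_cyclically_monotone c S \<and> Graph T \<subseteq> Graph S"
    proof (rule ex1I[of _ T])
      fix S assume S: "maximal_cyclically_monotone c S \<and> Graph T \<subseteq> Graph S"
      then have "Graph S = Graph T" using T unfolding maximal_cyclically_monotone_def by blast
      then show "S = T" by (rule Graph_inject)
    qed (use T in simp)
  qed
  have iv_iii: "cond_iii" if "cond_iv"
    using that chains_nearly_close_if_unique_extension
    unfolding cond_iii_def cond_iv_def fitzpatrick_inf_ge_iff by blast
  show ?thesis using iii_i i_ii ii_iii i_iv iv_iii by blast
qed

end
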